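(* The restricted polynomial equivalence problem over $\mathrm{Mat}_2(\mathbb{Z}_2)$ can be polytime-reduced to the following problem: given $k,n\in\mathbb{N}$ and expanded polynomials $p_1,\dots,p_k\in\mathbb{Z}_3[x_1,\dots,x_n]$, decide whether $\sum_{i=1}^k\alpha^{p_i(\mathbf{a})}=0$ for all $\mathbf{a}\in\{-1,1\}^n$.
   Context: $\alpha$ is a primitive element of the field $\mathbb{F}_4$ (e.g. $\alpha=\begin{pmatrix}0&1\\1&1\end{pmatrix}$ in $\mathbb{F}_4=\{0,\alpha,\alpha^2,I\}\subseteq\mathrm{Mat}_2(\mathbb{Z}_2)$); since $\alpha^3=1$, $\alpha^t$ is defined for $t\in\mathbb{Z}_3$; $p_i(\mathbf{a})$ is computed in $\mathbb{Z}_3$ and the sum is taken in $\mathbb{F}_4$. An expanded polynomial is given as $\sum_{\mathbf{e}\in I}c_{\mathbf{e}}x_1^{e_1}\cdots x_n^{e_n}$ with $I\subseteq\{0,1,2\}^n$ and $c_{\mathbf{e}}\in\mathbb{Z}_3\setminus\{0\}$. A restricted polynomial expression over $\mathrm{Mat}_2(\mathbb{Z}_2)$ is a finite, possibly empty, formal sum of nonempty words over noncommuting variables $x_1,\dots,x_n$ and elements of $\mathrm{GL}_2(\mathbb{Z}_2)$, evaluated in the matrix ring; the restricted polynomial equivalence problem asks, given such $p$, whether $p(\mathbf{x})=0$ for all $\mathbf{x}\in\mathrm{GL}_2(\mathbb{Z}_2)^n$. Polytime-reducible: there is a polynomial-time transformation $P$ of inputs with $A(e)\iff B(P(e))$. 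*)

theory Defs
  imports "HOL-Analysis.Analysis" "HOL-Computational_Algebra.Polynomial"
begin

section \<open>Deterministic multitape Turing machines\<close>

text \<open>
  The states of a machine are \<open>0, \<dots>, states M\<close>; it starts in state \<open>0\<close> and \<open>states M\<close> is its only
  halting state. The tape symbols are the numbers below \<open>symbols M\<close>, and \<open>0\<close> is the blank. The tapes
  are infinite in both directions. Given the current state and the list of the scanned symbols, one
  per tape, \<open>delta M\<close> yields the next state and, for each tape, the symbol to be written and the
  displacement of the head. By \<open>wf_tm\<close>, only a finite part of \<open>delta M\<close> is ever consulted.
\<close>

record tm =
  tapes :: nat
  symbols :: nat
  states :: nat
  delta :: "nat \<Rightarrow> nat list \<Rightarrow> nat \<times> (nat \<times> int) list"

definition wf_tm :: "tm \<Rightarrow> bool" where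
  "wf_tm M \<longleftrightarrow> 2 \<le> tapes M \<and> 0 < symbols M \<and>
     (\<forall>q < states M. \<forall>s. length s = tapes M \<and> set s \<subseteq> {..<symbols M} \<longrightarrow>
        (case delta M q s of (q', acts) \<Rightarrow>
           q' \<le> states M \<and> length acts = tapes M \<and>
           (\<forall>(b, d) \<in> set acts. b < symbols M \<and> d \<in> {-1, 0, 1})))"

type_synonym tape = "(int \<Rightarrow> nat) \<times> int"

type_synonym config = "nat \<times> tape list"

definition tm_step :: "tm \<Rightarrow> config \<Rightarrow> config" where
  "tm_step M = (\<lambda>(q, ts).
     if q < states M then
       (case delta M q (map (\<lambda>(c, h). c h) ts) of (q', acts) \<Rightarrow>
          (q', map2 (\<lambda>(b, d) (c, h). (c(h := b), h + d)) acts ts))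
     else (q, ts))"

definition tape_content :: "nat list \<Rightarrow> int \<Rightarrow> nat" where
  "tape_content w i = (if 0 \<le> i \<and> i < int (length w) then w ! nat i else 0)"

text \<open>The first tape is the input tape, the second one the output tape.\<close>

definition tm_init :: "tm \<Rightarrow> nat list \<Rightarrow> config" where
  "tm_init M w = (0, (tape_content w, 0) # replicate (tapes M - 1) (tape_content [], 0))"

text \<open>Halting configurations are fixed points of \<open>tm_step\<close>, so the following says that \<open>M\<close> halts on
  input \<open>w\<close> after at most \<open>t\<close> steps, with output \<open>v\<close>.\<close>

definition tm_computes_within :: "tm \<Rightarrow> nat \<Rightarrow> nat list \<Rightarrow> nat list \<Rightarrow> bool" where
  "tm_computes_within M t w v \<longleftrightarrow>
     (case (tm_step M ^^ t) (tm_init M w) of (q, ts) \<Rightarrow>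
        q = states M \<and> fst (ts ! 1) = tape_content v)"


section \<open>Polynomial-time reducibility of decision problems\<close>

text \<open>Encodings of instances are words over a finite set of positive numbers (\<open>0\<close> is the blank).\<close>

record 'a problem =
  instances :: "'a set"
  encode :: "'a \<Rightarrow> nat list"
  holds :: "'a \<Rightarrow> bool"

definition polytime_computable :: "'a set \<Rightarrow> ('a \<Rightarrow> nat list) \<Rightarrow> ('b \<Rightarrow> nat list) \<Rightarrow> ('a \<Rightarrow> 'b) \<Rightarrow> bool" where
  "polytime_computable D enc enc' P \<longleftrightarrow>
     (\<exists>M (b :: nat poly). wf_tm M \<and>
        (\<forall>e \<in> D. set (enc e) \<subseteq> {0<..<symbols M} \<and>
           tm_computes_within M (poly b (length (enc e))) (enc e) (enc' (P e))))"

definition polytime_reducible :: "'a problem \<Rightarrow> 'b problem \<Rightarrow> bool" where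
  "polytime_reducible A B \<longleftrightarrow>
     (\<exists>P. polytime_computable (instances A) (encode A) (encode B) P \<and>
        (\<forall>e \<in> instances A. P e \<in> instances B \<and> (holds A e \<longleftrightarrow> holds B (P e))))"


section \<open>Restricted polynomial equivalence over the 2-by-2 matrices over the integers modulo 2\<close>

type_synonym mat2 = "2 ^ 2 ^ 2"

datatype letter = Var nat | Const mat2

type_synonym matrix_expr = "letter list list"

definition restricted_exprs :: "matrix_expr set" where
  "restricted_exprs = {p. \<forall>w \<in> set p. w \<noteq> [] \<and> (\<forall>A. Const A \<in> set w \<longrightarrow> invertible A)}"

fun letter_value :: "(nat \<Rightarrow> mat2) \<Rightarrow> letter \<Rightarrow> mat2" where
  "letter_value x (Var i) = x i"
| "letter_value x (Const A) = A"

definition word_value :: "(nat \<Rightarrow> mat2) \<Rightarrow> letter list \<Rightarrow> mat2" where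
  "word_value x w = foldr (\<lambda>l B. letter_value x l ** B) w (mat 1)"

definition expr_value :: "(nat \<Rightarrow> mat2) \<Rightarrow> matrix_expr \<Rightarrow> mat2" where
  "expr_value x p = (\<Sum>w \<leftarrow> p. word_value x w)"

text \<open>Variable indices are written in binary, least significant bit first; the bits \<open>0\<close> and \<open>1\<close> are
  represented by the symbols \<open>1\<close> and \<open>2\<close>.\<close>

fun encode_index :: "nat \<Rightarrow> nat list" where
  "encode_index i = (if i = 0 then [] else (i mod 2 + 1) # encode_index (i div 2))"

declare encode_index.simps [simp del]

definition encode_entry :: "2 \<Rightarrow> nat" where
  "encode_entry a = (if a = 0 then 1 else 2)"

fun encode_letter :: "letter \<Rightarrow> nat list" where
  "encode_letter (Const A) =
     [3, encode_entry (A $ 1 $ 1), encode_entry (A $ 1 $ 2),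
         encode_entry (A $ 2 $ 1), encode_entry (A $ 2 $ 2)]"
| "encode_letter (Var i) = 4 # encode_index i"

definition encode_expr :: "matrix_expr \<Rightarrow> nat list" where
  "encode_expr p = concat (map (\<lambda>w. concat (map encode_letter w) @ [5]) p)"

definition restricted_equivalence_problem :: "matrix_expr problem" where
  "restricted_equivalence_problem =
     \<lparr>instances = restricted_exprs,
      encode = encode_expr,
      holds = (\<lambda>p. \<forall>x. (\<forall>i. invertible (x i)) \<longrightarrow> expr_value x p = 0)\<rparr>"


section \<open>Exponential sums over the field with four elements\<close>

text \<open>A polynomial is given by the list of its pairs \<open>(c\<^sub>e, e)\<close>; the numeral type \<open>3\<close> is the ring of
  integers modulo 3.\<close>

type_synonym expanded_poly = "(3 \<times> nat list) list"

definition expanded_polys :: "nat \<Rightarrow> expanded_poly set" where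
  "expanded_polys n = {p. distinct (map snd p) \<and>
     (\<forall>(c, e) \<in> set p. c \<noteq> 0 \<and> length e = n \<and> set e \<subseteq> {0, 1, 2})}"

definition expanded_poly_value :: "3 list \<Rightarrow> expanded_poly \<Rightarrow> 3" where
  "expanded_poly_value a p = (\<Sum>(c, e) \<leftarrow> p. c * (\<Prod>i<length a. a ! i ^ (e ! i)))"

definition primitive_element :: "'f::field \<Rightarrow> bool" where
  "primitive_element \<alpha> \<longleftrightarrow> \<alpha> \<noteq> 0 \<and> (\<forall>x. x \<noteq> 0 \<longrightarrow> (\<exists>k::nat. x = \<alpha> ^ k))"

text \<open>\<open>Rep_bit1 t\<close> is the representative of \<open>t\<close> in \<open>{0, 1, 2}\<close>.\<close>

definition power_mod3 :: "'f::field \<Rightarrow> 3 \<Rightarrow> 'f" where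
  "power_mod3 \<alpha> t = \<alpha> ^ nat (Rep_bit1 t)"

definition encode_expanded_poly :: "expanded_poly \<Rightarrow> nat list" where
  "encode_expanded_poly p =
     concat (map (\<lambda>(c, e). 4 # (nat (Rep_bit1 c) + 1) # map Suc e) p) @ [5]"

text \<open>An instance consists of \<open>n\<close> and the list of the polynomials; its length is \<open>k\<close>. The number \<open>n\<close>
  of variables is written in unary, in accordance with the exponent vectors, which are written out
  in full length \<open>n\<close>.\<close>

definition exp_sum_problem :: "'f::field \<Rightarrow> (nat \<times> expanded_poly list) problem" where
  "exp_sum_problem \<alpha> =
     \<lparr>instances = {(n, ps). set ps \<subseteq> expanded_polys n},
      encode = (\<lambda>(n, ps). replicate n 6 @ concat (map encode_expanded_poly ps)),
      holds = (\<lambda>(n, ps). \<forall>a. length a = n \<and> set a \<subseteq> {-1, 1} \<longrightarrow>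
                 (\<Sum>i<length ps. power_mod3 \<alpha> (expanded_poly_value a (ps ! i))) = 0)\<rparr>"

end

theory Submission
  imports Defs
begin

text \<open>
  The group of invertible matrices consists of the six elements \<open>\<alpha>\<^sup>t\<beta>\<^sup>s\<close> with \<open>\<alpha>\<^sup>3 = \<beta>\<^sup>2 = 1\<close> and
  \<open>\<beta>\<alpha>\<beta> = \<alpha>\<^sup>-\<^sup>1\<close>. Writing \<open>y = (-1)\<^sup>s\<close>, a product of such elements is \<open>\<alpha>\<^sup>f\<beta>\<^sup>s\<close> with
  \<open>f = t\<^sub>1 + y\<^sub>1 t\<^sub>2 + y\<^sub>1 y\<^sub>2 t\<^sub>3 + \<dots>\<close>, a polynomial over the integers modulo 3 once each exponent \<open>t\<close> is
  replaced by \<open>u + v\<close> with signs \<open>u\<close> and \<open>v\<close>. The value of an expression is therefore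
  \<open>A + B\<beta>\<close>, where \<open>A\<close> and \<open>B\<close> are the sums of \<open>\<alpha>\<^sup>f\<close> over the words with \<open>y = 1\<close> and \<open>y = -1\<close>. It vanishes
  if and only if \<open>A\<alpha>\<^sup>t + B\<alpha>\<^sup>-\<^sup>t = 0\<close> for all \<open>t\<close>, that is, if and only if the sum of \<open>\<alpha>\<^bsup>f + yt\<^esup>\<close> over all words
  vanishes for all \<open>t\<close>: each word is followed by an additional variable, in the place of its
  terminator, and only the power of \<open>\<alpha>\<close> in the product is retained.
\<close>

section \<open>Turing machines with a finite set of control states\<close>

text \<open>Mirrors \<open>tm_step\<close> over an arbitrary type of states, so that the control can
  carry structured data; numbering the states is left to \<open>finite_control_tm\<close>.\<close>

definition control_step :: "'q \<Rightarrow> ('q \<Rightarrow> nat list \<Rightarrow> 'q \<times> (nat \<times> int) list) \<Rightarrow> 'q \<times> tape list \<Rightarrow> 'q \<times> tape list" where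
  "control_step qf d = (\<lambda>(q, ts). if q = qf then (q, ts) else
     (case d q (map (\<lambda>(c, h). c h) ts) of (q', acts) \<Rightarrow>
        (q', map2 (\<lambda>(b, e) (c, h). (c(h := b), h + e)) acts ts)))"

text \<open>Listing \<open>Q\<close> with \<open>q0\<close> first and \<open>qf\<close> last turns
  its elements into the numbers 0, ..., \<open>n\<close> with the prescribed initial and halting
  state; the two machines then run in lockstep.\<close>

lemma finite_control_tm:
  assumes fin: "finite Q" and q0: "q0 \<in> Q" and qf: "qf \<in> Q" and ne: "q0 \<noteq> qf"
    and k: "2 \<le> k" and S: "0 < S"
    and closed: "\<And>q s. q \<in> Q \<Longrightarrow> q \<noteq> qf \<Longrightarrow> fst (d q s) \<in> Q"
    and acts: "\<And>q s. q \<in> Q \<Longrightarrow> q \<noteq> qf \<Longrightarrow> length s = k \<Longrightarrow> set s \<subseteq> {..<S} \<Longrightarrow>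
       length (snd (d q s)) = k \<and> (\<forall>(b, e) \<in> set (snd (d q s)). b < S \<and> e \<in> {-1, 0, 1})"
  obtains M where "wf_tm M" "symbols M = S"
    "\<And>t w v ts. (control_step qf d ^^ t) (q0, (tape_content w, 0) # replicate (k - 1) (tape_content [], 0)) = (qf, ts)
       \<Longrightarrow> fst (ts ! 1) = tape_content v \<Longrightarrow> tm_computes_within M t w v"
proof -
  obtain xs where xs: "set xs = Q - {q0, qf}" "distinct xs"
    using finite_distinct_list[of "Q - {q0, qf}"] fin by auto
  define qs where "qs = q0 # xs @ [qf]"
  define n where "n = Suc (length xs)"
  have set_qs: "set qs = Q" and dist: "distinct qs" and len: "length qs = Suc n"
    using xs q0 qf ne by (auto simp: qs_def n_def)
  have qs0: "qs ! 0 = q0" and qsn: "qs ! n = qf"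
    by (auto simp: qs_def n_def nth_append)
  define enc where "enc q = (THE i. i \<le> n \<and> qs ! i = q)" for q
  have enc_nth: "enc (qs ! i) = i" if "i \<le> n" for i
    unfolding enc_def using that dist len by (auto simp: nth_eq_iff_index_eq intro!: the_equality)
  have enc: "enc q \<le> n \<and> qs ! enc q = q" if q: "q \<in> Q" for q
  proof -
    obtain i where "i \<le> n" "q = qs ! i"
      using q len unfolding set_qs[symmetric] in_set_conv_nth by (auto simp: less_Suc_eq_le)
    then show ?thesis using enc_nth by simp
  qed
  have enc0: "enc q0 = 0" and encf: "enc qf = n"
    using enc_nth[of 0] enc_nth[of n] qs0 qsn by auto
  have enc_lt: "enc q < n \<longleftrightarrow> q \<noteq> qf" if "q \<in> Q" for q
    using enc[OF that] encf qsn by (auto simp: le_less)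
  define M where "M = \<lparr>tapes = k, symbols = S, states = n,
     delta = (\<lambda>i s. case d (qs ! i) s of (q', acts) \<Rightarrow> (enc q', acts))\<rparr>"
  have wf: "wf_tm M"
  proof -
    have "case delta M i s of (q', acts) \<Rightarrow> q' \<le> states M \<and> length acts = tapes M \<and>
           (\<forall>(b, d) \<in> set acts. b < symbols M \<and> d \<in> {-1, 0, 1})"
      if "i < states M" "length s = tapes M" "set s \<subseteq> {..<symbols M}" for i s
    proof -
      have i: "i < n" using that by (simp add: M_def)
      then have Q: "qs ! i \<in> Q" using nth_mem[of i qs] set_qs len by simp
      moreover have "qs ! i \<noteq> qf" using enc_nth[of i] encf i by auto
      ultimately show ?thesis
        using closed[of "qs ! i" s] acts[of "qs ! i" s] that enc[of "fst (d (qs ! i) s)"]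
        by (auto simp: M_def split: prod.splits)
    qed
    then show ?thesis using k S unfolding wf_tm_def by (simp add: M_def)
  qed
  have step: "tm_step M (enc q, ts) = (enc (fst (control_step qf d (q, ts))), snd (control_step qf d (q, ts)))
      \<and> fst (control_step qf d (q, ts)) \<in> Q" if "q \<in> Q" for q ts
  proof (cases "q = qf")
    case True
    then show ?thesis using that encf by (simp add: tm_step_def control_step_def M_def)
  next
    case False
    obtain q' acts where d: "d q (map (\<lambda>(c, h). c h) ts) = (q', acts)" by fastforce
    show ?thesis
      using False enc_lt[OF that] enc[OF that] closed[OF that False, of "map (\<lambda>(c, h). c h) ts"]
      by (simp add: tm_step_def control_step_def M_def d)
  qed
  have steps: "(tm_step M ^^ t) (enc q, ts) = (enc (fst ((control_step qf d ^^ t) (q, ts))), snd ((control_step qf d ^^ t) (q, ts)))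
      \<and> fst ((control_step qf d ^^ t) (q, ts)) \<in> Q" if "q \<in> Q" for q ts t
    using that
  proof (induction t)
    case (Suc t)
    then show ?case
      using step[of "fst ((control_step qf d ^^ t) (q, ts))" "snd ((control_step qf d ^^ t) (q, ts))"] by simp
  qed simp
  show thesis
  proof (rule that)
    show "wf_tm M" by (rule wf)
    show "symbols M = S" by (simp add: M_def)
    fix t w v ts
    assume "(control_step qf d ^^ t) (q0, (tape_content w, 0) # replicate (k - 1) (tape_content [], 0)) = (qf, ts)"
      and "fst (ts ! 1) = tape_content v"
    then show "tm_computes_within M t w v"
      using steps[OF q0, of t "(tape_content w, 0) # replicate (k - 1) (tape_content [], 0)"]
      by (auto simp: tm_computes_within_def tm_init_def enc0 encf M_def)
  qed
qed

lemma control_step_halted: "(control_step qf d ^^ t) (qf, ts) = (qf, ts)"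
  by (induction t) (auto simp: control_step_def)

section \<open>The machine\<close>

text \<open>The tapes are the input, the output, a copy of the input, and two mark tapes whose heads move
  together with the head on the copy. Every token of the input yields two monomials, written in two
  passes over the copy; each pass compares the current token with every token of the copy and writes
  one block of four exponents for it. On the mark tapes, the cell of the first symbol of a token
  holds the parity of its earlier occurrences in the current word, and a 2 if the token has been
  dealt with. The second pass updates both; \<open>Second_Marked\<close> means that it has already marked the
  current token, which is the first unmarked one.\<close>

datatype pass = First | Second | Second_Marked

text \<open>The first Boolean is the sign of the constants read so far in the current word, a second
  one the outcome of a comparison of tokens, and the number in \<open>Read\<close> the code read so
  far. The letters A and B in the names stand for the input tape and its copy.\<close>

datatype ctl = Copy | Rewind_Both | Start pass bool | Read pass bool nat | Rewind_A pass bool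
  | Cmp_Start pass bool | Cmp pass bool | Cmp_Back pass bool bool | Emit pass bool bool
  | Next_B pass bool | Rewind_B pass bool | Next_A bool | Halt

text \<open>These are the symbols for the coefficients 1 and -1 = 2:
  \<open>encode_expanded_poly\<close> writes a coefficient as its representative plus one.\<close>

definition coef_symbol :: "bool \<Rightarrow> nat" where
  "coef_symbol b = (if b then 2 else 3)"

text \<open>The bits \<open>a, b, c, d\<close> of a constant matrix are read as the binary number \<open>1abcd\<close>. The codes 25,
  23, 30, 22, 27, 29 belong to the matrices \<open>1, \<alpha>, \<alpha>\<^sup>2, \<beta>, \<alpha>\<beta>, \<alpha>\<^sup>2\<beta>\<close> with \<open>\<alpha> = (0 1; 1 1)\<close> and
  \<open>\<beta> = (0 1; 1 0)\<close>. In both definitions below, truth means \<open>1\<close> and falsity \<open>-1\<close>. The exponent of \<open>\<alpha>\<close> is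
  the sum of the signs \<open>const_coef\<close> in the two passes (\<open>0 = 1 - 1\<close>, \<open>1 = -1 - 1\<close> and \<open>2 = 1 + 1\<close>
  modulo 3).\<close>

definition const_coef :: "pass \<Rightarrow> nat \<Rightarrow> bool" where
  "const_coef ps m = (if ps = First then m \<notin> {23, 27} else m \<in> {29, 30})"

definition const_sign :: "nat \<Rightarrow> bool" where
  "const_sign m = (m \<in> {23, 25, 30})"

text \<open>\<open>act c x b y d\<close> consists of the next control state, the displacements on the input and on the
  three inner tapes, the symbols written on the latter, and the word appended to the output.\<close>

fun act :: "ctl \<Rightarrow> nat \<Rightarrow> nat \<Rightarrow> nat \<Rightarrow> nat \<Rightarrow> ctl \<times> int \<times> int \<times> nat \<times> nat \<times> nat \<times> nat list" where
  "act Copy x b y d = (if x = 0 then (Rewind_Both, -1, -1, b, y, d, [])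
     else (Copy, 1, 1, x, y, d, if 3 \<le> x then [6, 6, 6, 6] else []))"
| "act Rewind_Both x b y d = (if x = 0 then (Next_A True, 1, 1, b, y, d, [])
     else (Rewind_Both, -1, -1, b, y, d, []))"
| "act (Start ps sg) x b y d = (if x = 3 then (Read ps sg 1, 1, 0, b, y, d, [])
     else (Cmp_Start ps (sg \<or> ps \<noteq> First \<and> x = 5), 0, 0, b, y, d, [4, coef_symbol sg]))"
| "act (Read ps sg m) x b y d = (let m' = 2 * m + (if x = 2 then 1 else 0) in
     if m' < 16 then (Read ps sg m', 1, 0, b, y, d, [])
     else (Rewind_A ps (if ps = First then sg else sg = const_sign m'), 0, 0, b, y, d,
       [4, coef_symbol (sg = const_coef ps m')]))"
| "act (Rewind_A ps sg) x b y d = (if 3 \<le> x then (Cmp_Start ps sg, 0, 0, b, y, d, [])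
     else (Rewind_A ps sg, -1, 0, b, y, d, []))"
| "act (Cmp_Start ps sg) x b y d = (if b = 0 then (Rewind_B ps sg, 0, -1, b, y, d, [])
     else if x = b then (Cmp ps sg, 1, 1, b, y, d, []) else (Emit ps sg False, 0, 0, b, y, d, []))"
| "act (Cmp ps sg) x b y d = (if x = b \<and> x \<in> {1, 2} then (Cmp ps sg, 1, 1, b, y, d, [])
     else (Cmp_Back ps sg (x \<notin> {1, 2} \<and> b \<notin> {1, 2}), -1, -1, b, y, d, []))"
| "act (Cmp_Back ps sg e) x b y d = (if 3 \<le> x then (Emit ps sg e, 0, 0, b, y, d, [])
     else (Cmp_Back ps sg e, -1, -1, b, y, d, []))"
| "act (Emit ps sg e) x b y d =
     (Next_B (if ps = Second \<and> d = 0 then Second_Marked else ps) sg, 0, 1, b,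
      if ps = First then y else if x = 5 then 0 else if x = 4 \<and> e then (if y = 1 then 0 else 1) else y,
      if ps = Second then 2 else d,
      [if y = 1 then 2 else 1,
       if ps = First \<and> e then (if x = 3 then 3 else 2) else 1,
       if ps \<noteq> First \<and> e then (if x = 3 then 3 else 2) else 1,
       if d = 0 then 1 else 3])"
| "act (Next_B ps sg) x b y d = (if b \<in> {1, 2} then (Next_B ps sg, 0, 1, b, y, d, [])
     else (Cmp_Start ps sg, 0, 0, b, y, d, []))"
| "act (Rewind_B ps sg) x b y d = (if b \<noteq> 0 then (Rewind_B ps sg, 0, -1, b, y, d, [])
     else if ps = First then (Start Second sg, 0, 1, b, y, d, [])
     else (Next_A sg, 1, 1, b, y, d, if x = 5 then [5] else []))"
| "act (Next_A sg) x b y d = (if x \<in> {1, 2} then (Next_A sg, 1, 0, b, y, d, [])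
     else if x = 0 then (Halt, 0, 0, b, y, d, []) else (Start First sg, 0, 0, b, y, d, []))"
| "act Halt x b y d = (Halt, 0, 0, b, y, d, [])"

section \<open>Simulation of macro steps by machine steps\<close>

type_synonym macro_conf = "ctl \<times> int \<times> nat list \<times> (int \<Rightarrow> nat) \<times> int \<times> (int \<Rightarrow> nat) \<times> (int \<Rightarrow> nat)"

fun macro_step :: "(int \<Rightarrow> nat) \<Rightarrow> macro_conf \<Rightarrow> macro_conf" where
  "macro_step a (c, i, v, B, k, Y, D) = (case act c (a i) (B k) (Y k) (D k) of
     (c', di, dk, b, y, d, out) \<Rightarrow> (c', i + di, v @ out, B(k := b), k + dk, Y(k := y), D(k := d)))"

definition reach :: "(int \<Rightarrow> nat) \<Rightarrow> nat \<Rightarrow> macro_conf \<Rightarrow> macro_conf \<Rightarrow> bool" where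
  "reach a n x y = (\<exists>m\<le>n. (macro_step a ^^ m) x = y)"

text \<open>The machine writes one output symbol per step, so the list in its state buffers what is
  still to be written; \<open>act\<close> is consulted only when the buffer is empty.\<close>

fun machine_delta :: "ctl \<times> nat list \<Rightarrow> nat list \<Rightarrow> (ctl \<times> nat list) \<times> (nat \<times> int) list" where
  "machine_delta (c, x # xs) s = ((c, xs), [(s ! 0, 0), (x, 1), (s ! 2, 0), (s ! 3, 0), (s ! 4, 0)])"
| "machine_delta (c, []) s = (case act c (s ! 0) (s ! 2) (s ! 3) (s ! 4) of
     (c', di, dk, b, y, d, out) \<Rightarrow> ((c', out), [(s ! 0, di), (s ! 1, 0), (b, dk), (y, dk), (d, dk)]))"

fun tapes_of :: "(int \<Rightarrow> nat) \<Rightarrow> macro_conf \<Rightarrow> tape list" where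
  "tapes_of a (c, i, v, B, k, Y, D) =
     [(a, i), (tape_content v, int (length v)), (B, k), (Y, k), (D, k)]"

lemma tape_content_snoc: "(tape_content v)(int (length v) := x) = tape_content (v @ [x])"
  by (auto simp: tape_content_def fun_eq_iff nth_append)

lemma machine_delta_flush:
  "(control_step (Halt, []) machine_delta ^^ length xs) ((c, xs), tapes_of a (c', i, v, B, k, Y, D)) =
     ((c, []), tapes_of a (c', i, v @ xs, B, k, Y, D))"
proof (induction xs arbitrary: v)
  case (Cons x xs)
  have "control_step (Halt, []) machine_delta ((c, x # xs), tapes_of a (c', i, v, B, k, Y, D)) =
      ((c, xs), tapes_of a (c', i, v @ [x], B, k, Y, D))"
    by (simp add: control_step_def tape_content_snoc)
  then show ?case using Cons[of "v @ [x]"] by (simp add: funpow_swap1 del: tapes_of.simps)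
qed simp

lemma act_output_length: "length (snd (snd (snd (snd (snd (snd (act c x b y d))))))) \<le> 4"
  by (cases c) (auto simp: Let_def)

text \<open>One step consults \<open>act\<close> and at most four more empty the buffer. A
  configuration in \<open>Halt\<close> is a fixed point of \<open>macro_step\<close> and takes no
  step.\<close>

lemma machine_delta_macro_step:
  "\<exists>m\<le>5. (control_step (Halt, []) machine_delta ^^ m) ((fst x, []), tapes_of a x) = ((fst (macro_step a x), []), tapes_of a (macro_step a x))"
proof -
  obtain c i v B k Y D where x: "x = (c, i, v, B, k, Y, D)" by (metis prod.exhaust)
  show ?thesis
  proof (cases "c = Halt")
    case True
    then show ?thesis by (intro exI[of _ 0]) (simp add: x)
  next
    case False
    obtain c' di dk b y d out where act: "act c (a i) (B k) (Y k) (D k) = (c', di, dk, b, y, d, out)"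
      by (metis prod.exhaust)
    have "control_step (Halt, []) machine_delta ((c, []), tapes_of a x) =
        ((c', out), tapes_of a (c', i + di, v, B(k := b), k + dk, Y(k := y), D(k := d)))"
      using False by (simp add: control_step_def x act)
    then have "(control_step (Halt, []) machine_delta ^^ Suc (length out)) ((c, []), tapes_of a x) =
        ((c', []), tapes_of a (c', i + di, v @ out, B(k := b), k + dk, Y(k := y), D(k := d)))"
      using machine_delta_flush[of out c' a c'] by (simp add: funpow_swap1 del: tapes_of.simps)
    moreover have "length out \<le> 4" using act_output_length[of c "a i" "B k" "Y k" "D k"] act by simp
    ultimately show ?thesis
      by (intro exI[of _ "Suc (length out)"]) (simp add: x act del: tapes_of.simps)
  qed
qed

lemma machine_delta_reach:
  assumes "reach a n x y"
  shows "\<exists>m\<le>5 * n. (control_step (Halt, []) machine_delta ^^ m) ((fst x, []), tapes_of a x) = ((fst y, []), tapes_of a y)"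
proof -
  have "\<exists>m'\<le>5 * m. (control_step (Halt, []) machine_delta ^^ m') ((fst x, []), tapes_of a x)
      = ((fst ((macro_step a ^^ m) x), []), tapes_of a ((macro_step a ^^ m) x))" for m
  proof (induction m)
    case 0
    then show ?case by (intro exI[of _ 0]) simp
  next
    case (Suc m)
    then obtain m1 where m1: "m1 \<le> 5 * m" "(control_step (Halt, []) machine_delta ^^ m1) ((fst x, []), tapes_of a x)
      = ((fst ((macro_step a ^^ m) x), []), tapes_of a ((macro_step a ^^ m) x))" by blast
    obtain m2 where "m2 \<le> 5" "(control_step (Halt, []) machine_delta ^^ m2) ((fst ((macro_step a ^^ m) x), []), tapes_of a ((macro_step a ^^ m) x))
      = ((fst ((macro_step a ^^ Suc m) x), []), tapes_of a ((macro_step a ^^ Suc m) x))"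
      using machine_delta_macro_step[of "(macro_step a ^^ m) x" a] by auto
    then show ?case using m1 by (intro exI[of _ "m2 + m1"]) (simp add: funpow_add del: tapes_of.simps)
  qed
  moreover obtain m where "m \<le> n" "(macro_step a ^^ m) x = y" using assms by (auto simp: reach_def)
  ultimately show ?thesis by (metis (no_types, lifting) le_trans mult_le_mono2)
qed

section \<open>Finiteness and closure of the control\<close>

definition ctls :: "ctl set" where
  "ctls = {Copy, Rewind_Both, Halt} \<union> range (case_prod Start) \<union>
     (\<lambda>(ps, sg, m). Read ps sg m) ` (UNIV \<times> UNIV \<times> {..<16}) \<union>
     range (case_prod Rewind_A) \<union> range (case_prod Cmp_Start) \<union> range (case_prod Cmp) \<union>
     range (\<lambda>(ps, sg, e). Cmp_Back ps sg e) \<union> range (\<lambda>(ps, sg, e). Emit ps sg e) \<union>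
     range (case_prod Next_B) \<union> range (case_prod Rewind_B) \<union> range Next_A"

instance pass :: finite
proof
  have "(UNIV :: pass set) = {First, Second, Second_Marked}" by (auto intro: pass.exhaust)
  then show "finite (UNIV :: pass set)" by (metis finite.emptyI finite_insert)
qed

lemma finite_ctls: "finite ctls"
  unfolding ctls_def by simp

text \<open>Only \<open>Read\<close> has an infinite range of arguments; its number stays below 16
  because the fourth bit after the leading 1 ends the reading.\<close>

lemma mem_ctls_iff: "c \<in> ctls \<longleftrightarrow> (case c of Read ps sg m \<Rightarrow> m < 16 | _ \<Rightarrow> True)"
  by (cases c) (auto simp: ctls_def image_iff)

lemma act_closed_aux:
  assumes "c \<in> ctls"
  shows "case act c x b y d of (c', di, dk, b', y', d', out) \<Rightarrow>
    c' \<in> ctls \<and> length out \<le> 4 \<and> list_all (\<lambda>z. z < 7) out \<and> di \<in> {-1, 0, 1} \<and> dk \<in> {-1, 0, 1} \<and>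
    (x < 7 \<longrightarrow> b < 7 \<longrightarrow> b' < 7) \<and> (y < 7 \<longrightarrow> y' < 7) \<and> (d < 7 \<longrightarrow> d' < 7)"
  using assms by (cases c) (simp_all add: mem_ctls_iff Let_def coef_symbol_def)

lemma act_closed:
  assumes "c \<in> ctls" "act c x b y d = (c', di, dk, b', y', d', out)"
  shows "c' \<in> ctls" "length out \<le> 4" "set out \<subseteq> {..<7}" "di \<in> {-1, 0, 1}" "dk \<in> {-1, 0, 1}"
    "x < 7 \<Longrightarrow> b < 7 \<Longrightarrow> b' < 7" "y < 7 \<Longrightarrow> y' < 7" "d < 7 \<Longrightarrow> d' < 7"
  using act_closed_aux[OF assms(1), of x b y d] assms(2) by (auto simp: list_all_iff)

lemma machine_tm:
  obtains M where "wf_tm M" "symbols M = 7"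
    "\<And>w n i v B k Y D t. reach (tape_content w) n (Copy, 0, [], \<lambda>_. 0, 0, \<lambda>_. 0, \<lambda>_. 0) (Halt, i, v, B, k, Y, D)
       \<Longrightarrow> 5 * n \<le> t \<Longrightarrow> tm_computes_within M t w v"
proof -
  define Q where "Q = ctls \<times> {xs. set xs \<subseteq> {..<7::nat} \<and> length xs \<le> 4}"
  obtain M where M: "wf_tm M" "symbols M = 7"
    "\<And>t w v ts. (control_step (Halt, []) machine_delta ^^ t) ((Copy, []), (tape_content w, 0) # replicate (5 - 1) (tape_content [], 0)) = ((Halt, []), ts)
       \<Longrightarrow> fst (ts ! 1) = tape_content v \<Longrightarrow> tm_computes_within M t w v"
  proof (rule finite_control_tm[of Q "(Copy, [])" "(Halt, [])" 5 7 machine_delta])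
    show "finite Q" unfolding Q_def using finite_ctls finite_lists_length_le[of "{..<7::nat}" 4] by simp
    show "(Copy, []) \<in> Q" "(Halt, []) \<in> Q" by (auto simp: Q_def ctls_def)
    show "fst (machine_delta q s) \<in> Q" if "q \<in> Q" for q s
    proof (cases "(q, s)" rule: machine_delta.cases)
      case (2 c s)
      then show ?thesis using that act_closed(1-3)[of c "s ! 0" "s ! 2" "s ! 3" "s ! 4"]
        by (auto simp: Q_def split: prod.splits)
    qed (use that in \<open>auto simp: Q_def\<close>)
    show "length (snd (machine_delta q s)) = 5 \<and> (\<forall>(b, e)\<in>set (snd (machine_delta q s)). b < 7 \<and> e \<in> {- 1, 0, 1})"
      if "q \<in> Q" "length s = 5" "set s \<subseteq> {..<7}" for q s
    proof -
      have s: "s ! j < 7" if "j < 5" for j using \<open>length s = 5\<close> \<open>set s \<subseteq> {..<7}\<close> that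
        by (metis lessThan_iff nth_mem subsetD)
      show ?thesis
      proof (cases "(q, s)" rule: machine_delta.cases)
        case (2 c s')
        obtain c' di dk b y d out where act: "act c (s ! 0) (s ! 2) (s ! 3) (s ! 4) = (c', di, dk, b, y, d, out)"
          by (metis prod.exhaust)
        have "c \<in> ctls" using 2 that by (auto simp: Q_def)
        from act_closed(4-8)[OF this act] s show ?thesis using 2 act by auto
      qed (use that s in \<open>auto simp: Q_def\<close>)
    qed
  qed auto
  show thesis
  proof (rule that[OF M(1,2)])
    fix w n i v B k Y D t
    assume r: "reach (tape_content w) n (Copy, 0, [], \<lambda>_. 0, 0, \<lambda>_. 0, \<lambda>_. 0) (Halt, i, v, B, k, Y, D)"
      and t: "5 * n \<le> t"
    let ?x = "((Copy, []), (tape_content w, 0) # replicate (5 - 1) (tape_content [], 0))"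
    let ?y = "((Halt, []), tapes_of (tape_content w) (Halt, i, v, B, k, Y, D))"
    have blank: "tape_content [] = (\<lambda>_. 0)" by (auto simp: tape_content_def)
    obtain m where m: "m \<le> 5 * n" "(control_step (Halt, []) machine_delta ^^ m) ?x = ?y"
      using machine_delta_reach[OF r] by (auto simp: blank numeral_eq_Suc)
    \<comment> \<open>The definition of \<open>tm_computes_within\<close> inspects exactly time
      \<open>t\<close>, so the run is padded with idle steps in the halting configuration.\<close>
    have "(control_step (Halt, []) machine_delta ^^ ((t - m) + m)) ?x = ?y"
      unfolding funpow_add o_apply m(2) by (rule control_step_halted)
    then have "(control_step (Halt, []) machine_delta ^^ t) ?x = ?y" using m(1) t by simp
    then show "tm_computes_within M t w v" by (rule M(3)) simp
  qed
qed

section \<open>Runs of the machine\<close>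

text \<open>The terminator of a word is the token \<open>None\<close>.\<close>

type_synonym token = "letter option"

fun head_symbol :: "token \<Rightarrow> nat" where
  "head_symbol None = 5"
| "head_symbol (Some (Var i)) = 4"
| "head_symbol (Some (Const A)) = 3"

fun tail_symbols :: "token \<Rightarrow> nat list" where
  "tail_symbols None = []"
| "tail_symbols (Some (Var i)) = encode_index i"
| "tail_symbols (Some (Const A)) = [encode_entry (A $ 1 $ 1), encode_entry (A $ 1 $ 2),
     encode_entry (A $ 2 $ 1), encode_entry (A $ 2 $ 2)]"

definition encode_token :: "token \<Rightarrow> nat list" where
  "encode_token t = head_symbol t # tail_symbols t"

definition const_code :: "mat2 \<Rightarrow> nat" where
  "const_code A = foldl (\<lambda>m x. 2 * m + (if x = 2 then 1 else 0)) 1 (tail_symbols (Some (Const A)))"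

text \<open>The prefix sign y_1 y_2 ... of a word factors into the sign of its constants, kept by
  \<open>next_sign\<close>, and the signs of its variables, for which parities suffice as y^2 = 1.
  The terminator resets both.\<close>

fun next_parity :: "token \<Rightarrow> (token \<Rightarrow> nat) \<Rightarrow> token \<Rightarrow> nat" where
  "next_parity None g = (\<lambda>_. 0)"
| "next_parity (Some (Var i)) g = g(Some (Var i) := 1 - g (Some (Var i)))"
| "next_parity (Some (Const A)) g = g"

fun next_sign :: "token \<Rightarrow> bool \<Rightarrow> bool" where
  "next_sign None sg = True"
| "next_sign (Some (Var i)) sg = sg"
| "next_sign (Some (Const A)) sg = (sg = const_sign (const_code A))"

text \<open>A variable or terminator contributes the prefix sign times u + v with its own unknowns u
  and v; for a constant, u and v are known signs, one per pass, and are absorbed into the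
  coefficients.\<close>

fun coef_sign :: "pass \<Rightarrow> token \<Rightarrow> bool \<Rightarrow> bool" where
  "coef_sign ps (Some (Const A)) sg = (sg = const_coef ps (const_code A))"
| "coef_sign ps _ sg = sg"

fun token_exponent :: "token \<Rightarrow> nat" where
  "token_exponent (Some (Const A)) = 2"
| "token_exponent _ = 1"

text \<open>A constant contributes even exponents, hence the factor 1, but they still tell the two
  monomials of its two passes apart. The last entry has no influence on the value either: it makes
  the exponent vectors of a polynomial distinct, so that equal monomials need not be collected.\<close>

definition exp_block :: "pass \<Rightarrow> token \<Rightarrow> (token \<Rightarrow> nat) \<Rightarrow> nat \<Rightarrow> nat \<Rightarrow> token \<Rightarrow> nat list" where
  "exp_block ps t g j r t' =
     [g t',
      if ps = First \<and> t' = t then token_exponent t else 0,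
      if ps \<noteq> First \<and> t' = t then token_exponent t else 0,
      if r < j then 2 else 0]"

definition exp_vec :: "token list \<Rightarrow> pass \<Rightarrow> token \<Rightarrow> (token \<Rightarrow> nat) \<Rightarrow> nat \<Rightarrow> nat list" where
  "exp_vec T ps t g j = concat (map (\<lambda>r. exp_block ps t g j r (T ! r)) [0..<length T])"

definition monomial_output :: "token list \<Rightarrow> pass \<Rightarrow> token \<Rightarrow> (token \<Rightarrow> nat) \<Rightarrow> bool \<Rightarrow> nat \<Rightarrow> nat list" where
  "monomial_output T ps t g sg j =
     4 # coef_symbol (coef_sign ps t sg) # map Suc (exp_vec T ps t g j)"

fun output_from :: "token list \<Rightarrow> nat \<Rightarrow> (token \<Rightarrow> nat) \<Rightarrow> bool \<Rightarrow> token list \<Rightarrow> nat list" where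
  "output_from T j g sg [] = []"
| "output_from T j g sg (t # ts) =
     monomial_output T First t g sg j @ monomial_output T Second t g sg j @
     (if t = None then [5] else []) @
     output_from T (Suc j) (next_parity t g) (next_sign t sg) ts"

section \<open>Alphabet and injectivity of the token encoding\<close>

lemma set_encode_index: "set (encode_index i) \<subseteq> {1, 2}"
proof (induction i rule: encode_index.induct)
  case (1 i)
  then show ?case by (subst encode_index.simps) auto
qed

lemma set_tail_symbols: "set (tail_symbols t) \<subseteq> {1, 2}"
  by (cases t rule: tail_symbols.cases) (use set_encode_index in \<open>auto simp: encode_entry_def\<close>)

lemma encode_index_inject: "encode_index i = encode_index j \<Longrightarrow> i = j"
proof (induction i arbitrary: j rule: encode_index.induct)
  case (1 i)
  show ?case
  proof (cases "i = 0 \<or> j = 0")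
    case True
    then show ?thesis using 1(2) encode_index.simps[of i] encode_index.simps[of j] by (auto split: if_splits)
  next
    case False
    then have "i mod 2 = j mod 2" "encode_index (i div 2) = encode_index (j div 2)"
      using 1(2) encode_index.simps[of i] encode_index.simps[of j] by auto
    then have "i mod 2 = j mod 2" "i div 2 = j div 2" using 1(1) False by auto
    then show ?thesis by (metis div_mult_mod_eq)
  qed
qed

lemma bit_cases: "x = 0 \<or> x = (1 :: 2)"
  using exhaust_2[of x] by auto

lemma encode_entry_inject: "encode_entry x = encode_entry y \<longleftrightarrow> x = y"
  using bit_cases[of x] bit_cases[of y] by (auto simp: encode_entry_def)

text \<open>This lets a symbolwise comparison on the tapes decide equality of tokens.\<close>

lemma token_inject:
  assumes "head_symbol t = head_symbol t'" "tail_symbols t = tail_symbols t'"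
  shows "t = t'"
  using assms
  by (cases t rule: head_symbol.cases; cases t' rule: head_symbol.cases)
     (auto simp: encode_entry_inject vec_eq_iff forall_2 dest: encode_index_inject)

lemma head_symbol_range: "3 \<le> head_symbol t" "head_symbol t \<le> 5"
  by (cases t rule: head_symbol.cases; simp)+

section \<open>Composition of time-bounded runs\<close>

lemma reach_refl: "reach a n x x"
  unfolding reach_def by (intro exI[of _ 0]) simp

lemma reach_trans: "reach a n x y \<Longrightarrow> reach a m y z \<Longrightarrow> reach a (n + m) x z"
  unfolding reach_def
proof (elim exE conjE)
  fix k l assume "k \<le> n" "(macro_step a ^^ k) x = y" "l \<le> m" "(macro_step a ^^ l) y = z"
  then show "\<exists>ma\<le>n + m. (macro_step a ^^ ma) x = z"
    by (intro exI[of _ "l + k"]) (simp add: funpow_add)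
qed

lemma reach_mono: "reach a n x y \<Longrightarrow> n \<le> m \<Longrightarrow> reach a m x y"
  unfolding reach_def using le_trans by blast

lemma reach_step: "macro_step a x = y \<Longrightarrow> reach a n y z \<Longrightarrow> reach a (Suc n) x z"
proof -
  assume "macro_step a x = y" "reach a n y z"
  moreover from this have "reach a 1 x y" unfolding reach_def by (intro exI[of _ 1]) simp
  ultimately show ?thesis using reach_trans[of a 1 x y n z] by simp
qed

section \<open>Positions of the tokens on the tape\<close>

definition content :: "token list \<Rightarrow> int \<Rightarrow> nat" where
  "content T = tape_content (concat (map encode_token T))"

definition input_length :: "token list \<Rightarrow> nat" where
  "input_length T = length (concat (map encode_token T))"

definition pos :: "token list \<Rightarrow> nat \<Rightarrow> int" where
  "pos T q = int (length (concat (map encode_token (take q T))))"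

lemma tape_content_append_right:
  "tape_content (xs @ ys) (int (length xs) + int r) = tape_content ys (int r)"
  by (auto simp: tape_content_def nth_append nat_add_distrib)

lemma pos_0 [simp]: "pos T 0 = 0"
  by (simp add: pos_def)

lemma pos_length: "pos T (length T) = int (input_length T)"
  by (simp add: pos_def input_length_def)

lemma pos_Suc: "q < length T \<Longrightarrow> pos T (Suc q) = pos T q + 1 + int (length (tail_symbols (T ! q)))"
  by (simp add: pos_def take_Suc_conv_app_nth encode_token_def)

lemma content_pos:
  assumes "q \<le> length T"
  shows "content T (pos T q + int r) = tape_content (concat (map encode_token (drop q T))) (int r)"
proof -
  have "concat (map encode_token T) =
      concat (map encode_token (take q T)) @ concat (map encode_token (drop q T))"
    by (metis append_take_drop_id concat_append map_append)
  then show ?thesis unfolding content_def pos_def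
    using tape_content_append_right[of "concat (map encode_token (take q T))" "concat (map encode_token (drop q T))" r] by simp
qed

lemma content_token:
  assumes "q < length T"
  shows "content T (pos T q) = head_symbol (T ! q)"
    and "r < length (tail_symbols (T ! q)) \<Longrightarrow> content T (pos T q + 1 + int r) = tail_symbols (T ! q) ! r"
proof -
  have d: "drop q T = T ! q # drop (Suc q) T" using assms by (simp add: Cons_nth_drop_Suc)
  show "content T (pos T q) = head_symbol (T ! q)"
    using content_pos[of q T 0] assms by (simp add: d encode_token_def tape_content_def)
  show "content T (pos T q + 1 + int r) = tail_symbols (T ! q) ! r" if "r < length (tail_symbols (T ! q))"
    using content_pos[of q T "Suc r"] assms that
    by (simp add: d encode_token_def tape_content_def nth_append nat_add_distrib add.assoc)
qed

lemma content_end: "content T (pos T (length T)) = 0"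
  using content_pos[of "length T" T 0] by (simp add: tape_content_def)

text \<open>This is the stopping condition of the loops that pass over bits; the case
  \<open>q = length T\<close> is the blank behind the last token.\<close>

lemma content_no_bit: "q \<le> length T \<Longrightarrow> content T (pos T q) \<notin> {1, 2}"
  using content_token(1)[of q T] content_end[of T] head_symbol_range(1)[of "T ! q"]
  by (cases "q = length T") auto

lemma content_zero_iff: "content T i = 0 \<longleftrightarrow> i < 0 \<or> int (input_length T) \<le> i"
proof -
  have "x \<noteq> 0" if "x \<in> set (encode_token t)" for x t
    using that set_tail_symbols[of t] head_symbol_range(1)[of t] by (auto simp: encode_token_def)
  then have "\<forall>x \<in> set (concat (map encode_token T)). x \<noteq> 0"
    by fastforce
  then have "concat (map encode_token T) ! nat i \<noteq> 0" if "0 \<le> i" "i < int (input_length T)"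
    using that nth_mem[of "nat i" "concat (map encode_token T)"] unfolding input_length_def
    by (simp del: length_concat set_concat)
  then show ?thesis unfolding content_def tape_content_def input_length_def[symmetric] by auto
qed

lemma tail_length: "q < length T \<Longrightarrow> Suc (length (tail_symbols (T ! q))) \<le> input_length T"
proof -
  assume q: "q < length T"
  have "input_length T = input_length (take q T) + input_length (drop q T)"
    unfolding input_length_def
    by (metis append_take_drop_id concat_append length_append map_append)
  then show ?thesis using q
    by (simp add: input_length_def encode_token_def Cons_nth_drop_Suc[symmetric])
qed

lemma length_le_input_length: "length T \<le> input_length T"
  unfolding input_length_def by (induction T) (auto simp: encode_token_def)

lemma pos_less: "q < r \<Longrightarrow> r \<le> length T \<Longrightarrow> pos T q < pos T r"
proof (induction r)
  case (Suc r)
  then show ?case using pos_Suc[of r T] by (cases "q = r") auto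
qed simp

lemma pos_inject: "q \<noteq> r \<Longrightarrow> q \<le> length T \<Longrightarrow> r \<le> length T \<Longrightarrow> pos T q \<noteq> pos T r"
  using pos_less[of q r T] pos_less[of r q T] by (cases "q < r") auto

section \<open>The elementary loops of the machine\<close>

lemma Cmp_run:
  assumes "\<And>r. r < length xs \<Longrightarrow> a (i + int r) = xs ! r" "a (i + int (length xs)) \<notin> {1, 2}"
    and "\<And>r. r < length ys \<Longrightarrow> B (k + int r) = ys ! r" "B (k + int (length ys)) \<notin> {1, 2}"
    and "set xs \<subseteq> {1, 2}" "set ys \<subseteq> {1, 2}"
  shows "\<exists>m\<le>length xs. reach a (Suc (length xs)) (Cmp ps sg, i, v, B, k, Y, D)
    (Cmp_Back ps sg (xs = ys), i + int m - 1, v, B, k + int m - 1, Y, D)"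
  using assms
proof (induction xs arbitrary: ys i k)
  case Nil
  have "(B k \<notin> {1, 2}) = (ys = [])"
    using Nil(3)[of 0] Nil(4,6) by (cases ys) auto
  then have "macro_step a (Cmp ps sg, i, v, B, k, Y, D) =
      (Cmp_Back ps sg ([] = ys), i + int 0 - 1, v, B, k + int 0 - 1, Y, D)"
    using Nil(2) by (auto simp: fun_upd_idem)
  from reach_step[OF this reach_refl] show ?case by auto
next
  case (Cons x xs)
  have x: "a i = x" "x \<in> {1, 2}" using Cons(2)[of 0] Cons(6) by auto
  \<comment> \<open>The witness \<open>m\<close> counts the symbols on which both lists agree from
    the start. Both heads have then moved equally far, and the -1 is the first step back, made on
    leaving \<open>Cmp\<close>.\<close>
  show ?case
  proof (cases "\<exists>ys'. ys = x # ys'")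
    case True
    then obtain ys' where ys: "ys = x # ys'" by blast
    have b: "B k = x" using Cons(4)[of 0] ys by simp
    have "\<exists>m\<le>length xs. reach a (Suc (length xs)) (Cmp ps sg, i + 1, v, B, k + 1, Y, D)
      (Cmp_Back ps sg (xs = ys'), i + 1 + int m - 1, v, B, k + 1 + int m - 1, Y, D)"
    proof (rule Cons.IH)
      fix r assume "r < length xs"
      then show "a (i + 1 + int r) = xs ! r" using Cons(2)[of "Suc r"] by (simp add: add.assoc)
    next
      fix r assume "r < length ys'"
      then show "B (k + 1 + int r) = ys' ! r" using Cons(4)[of "Suc r"] ys by (simp add: add.assoc)
    qed (use Cons ys in \<open>auto simp: add.assoc\<close>)
    then obtain m where m: "m \<le> length xs" "reach a (Suc (length xs)) (Cmp ps sg, i + 1, v, B, k + 1, Y, D)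
      (Cmp_Back ps sg (xs = ys'), i + 1 + int m - 1, v, B, k + 1 + int m - 1, Y, D)" by blast
    have "macro_step a (Cmp ps sg, i, v, B, k, Y, D) = (Cmp ps sg, i + 1, v, B, k + 1, Y, D)"
      using x b by (simp add: fun_upd_idem)
    from reach_step[OF this m(2)] m(1) ys show ?thesis by (intro exI[of _ "Suc m"]) simp
  next
    case False
    then have "B k \<noteq> x" using x Cons(4)[of 0] Cons(5,7) by (cases ys) auto
    then have "macro_step a (Cmp ps sg, i, v, B, k, Y, D) =
        (Cmp_Back ps sg (x # xs = ys), i + int 0 - 1, v, B, k + int 0 - 1, Y, D)"
      using x False by auto
    from reach_step[OF this reach_refl] show ?thesis by (intro exI[of _ 0]) simp
  qed
qed

text \<open>Only the input head looks for the first symbol of its token; the head on the copy is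
  equally far from the start of its own token and arrives there at the same time.\<close>

lemma Cmp_Back_run:
  assumes "\<And>r. 0 < r \<Longrightarrow> r \<le> m \<Longrightarrow> a (i + int r) < 3" "3 \<le> a i"
  shows "reach a (Suc m) (Cmp_Back ps sg e, i + int m, v, B, k + int m, Y, D) (Emit ps sg e, i, v, B, k, Y, D)"
  using assms(1)
proof (induction m)
  case 0
  then show ?case using assms(2) by (auto intro!: reach_step[OF refl] simp: reach_refl)
next
  case (Suc m)
  have "macro_step a (Cmp_Back ps sg e, i + int (Suc m), v, B, k + int (Suc m), Y, D)
     = (Cmp_Back ps sg e, i + int m, v, B, k + int m, Y, D)"
    using Suc(2)[of "Suc m"] by simp
  from reach_step[OF this Suc.IH] Suc(2) show ?case by simp
qed

lemma Next_B_run: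
  assumes "\<And>r. r < n \<Longrightarrow> B (k + int r) \<in> {1, 2}" "B (k + int n) \<notin> {1, 2}"
  shows "reach a (Suc n) (Next_B ps sg, i, v, B, k, Y, D) (Cmp_Start ps sg, i, v, B, k + int n, Y, D)"
  using assms
proof (induction n arbitrary: k)
  case 0
  then show ?case by (auto intro!: reach_step[OF refl] simp: reach_refl)
next
  case (Suc n)
  have "macro_step a (Next_B ps sg, i, v, B, k, Y, D) = (Next_B ps sg, i, v, B, k + 1, Y, D)"
    using Suc(2)[of 0] by simp
  moreover have "reach a (Suc n) (Next_B ps sg, i, v, B, k + 1, Y, D) (Cmp_Start ps sg, i, v, B, k + 1 + int n, Y, D)"
  proof (rule Suc.IH)
    fix r assume "r < n"
    then show "B (k + 1 + int r) \<in> {1, 2}" using Suc(2)[of "Suc r"] by (simp add: add.assoc)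
  qed (use Suc(3) in \<open>simp add: add.assoc\<close>)
  ultimately show ?case using reach_step by (simp add: add.assoc)
qed

lemma Next_A_run:
  assumes "\<And>r. r < n \<Longrightarrow> a (i + int r) \<in> {1, 2}"
  shows "reach a n (Next_A sg, i, v, B, k, Y, D) (Next_A sg, i + int n, v, B, k, Y, D)"
  using assms
proof (induction n arbitrary: i)
  case 0
  then show ?case by (simp add: reach_refl)
next
  case (Suc n)
  have "macro_step a (Next_A sg, i, v, B, k, Y, D) = (Next_A sg, i + 1, v, B, k, Y, D)"
    using Suc(2)[of 0] by simp
  moreover have "reach a n (Next_A sg, i + 1, v, B, k, Y, D) (Next_A sg, i + 1 + int n, v, B, k, Y, D)"
  proof (rule Suc.IH)
    fix r assume "r < n"
    then show "a (i + 1 + int r) \<in> {1, 2}" using Suc(2)[of "Suc r"] by (simp add: add.assoc)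
  qed
  ultimately show ?case using reach_step by (simp add: add.assoc)
qed

lemma Rewind_B_run:
  assumes "\<And>r. r < n \<Longrightarrow> B (int r) \<noteq> 0"
  shows "reach a n (Rewind_B ps sg, i, v, B, int n - 1, Y, D) (Rewind_B ps sg, i, v, B, - 1, Y, D)"
  using assms(1)
proof (induction n)
  case 0
  then show ?case by (simp add: reach_refl)
next
  case (Suc n)
  have "macro_step a (Rewind_B ps sg, i, v, B, int (Suc n) - 1, Y, D) = (Rewind_B ps sg, i, v, B, int n - 1, Y, D)"
    using Suc(2)[of n] by simp
  from reach_step[OF this Suc.IH] Suc(2) show ?case by simp
qed

lemma Rewind_Both_run:
  assumes "\<And>r. r < n \<Longrightarrow> a (int r) \<noteq> 0" "a (- 1) = 0"
  shows "reach a (Suc n) (Rewind_Both, int n - 1, v, B, int n - 1, Y, D) (Next_A True, 0, v, B, 0, Y, D)"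
  using assms(1)
proof (induction n)
  case 0
  then show ?case using assms(2) by (auto intro!: reach_step[OF refl] simp: reach_refl)
next
  case (Suc n)
  have "macro_step a (Rewind_Both, int (Suc n) - 1, v, B, int (Suc n) - 1, Y, D) = (Rewind_Both, int n - 1, v, B, int n - 1, Y, D)"
    using Suc(2)[of n] by simp
  from reach_step[OF this Suc.IH] Suc(2) show ?case by simp
qed

section \<open>Comparing tokens and writing one monomial\<close>

lemma compare_run:
  assumes "j < length T" "q < length T"
  shows "reach (content T) (2 * input_length T + 1) (Cmp_Start ps sg, pos T j, v, content T, pos T q, Y, D)
     (Emit ps sg (T ! q = T ! j), pos T j, v, content T, pos T q, Y, D)"
proof -
  let ?a = "content T" and ?xs = "tail_symbols (T ! j)" and ?ys = "tail_symbols (T ! q)"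
  have nz: "head_symbol (T ! q) \<noteq> 0" using head_symbol_range(1)[of "T ! q"] by linarith
  show ?thesis
  proof (cases "head_symbol (T ! j) = head_symbol (T ! q)")
    case False
    then have "T ! q \<noteq> T ! j" by auto
    then have "macro_step ?a (Cmp_Start ps sg, pos T j, v, ?a, pos T q, Y, D) =
       (Emit ps sg (T ! q = T ! j), pos T j, v, ?a, pos T q, Y, D)"
      using False nz content_token(1)[OF assms(1)] content_token(1)[OF assms(2)] by (simp add: fun_upd_idem)
    from reach_step[OF this reach_refl, of "2 * input_length T"] show ?thesis by simp
  next
    case True
    have s: "macro_step ?a (Cmp_Start ps sg, pos T j, v, ?a, pos T q, Y, D) =
       (Cmp ps sg, pos T j + 1, v, ?a, pos T q + 1, Y, D)"
      using True nz content_token(1)[OF assms(1)] content_token(1)[OF assms(2)] by (simp add: fun_upd_idem)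
    have "\<exists>m\<le>length ?xs. reach ?a (Suc (length ?xs)) (Cmp ps sg, pos T j + 1, v, ?a, pos T q + 1, Y, D)
      (Cmp_Back ps sg (?xs = ?ys), pos T j + 1 + int m - 1, v, ?a, pos T q + 1 + int m - 1, Y, D)"
    proof (rule Cmp_run)
      show "content T (pos T j + 1 + int (length ?xs)) \<notin> {1, 2}"
        using content_no_bit[of "Suc j" T] pos_Suc[of j T] assms by simp
      show "content T (pos T q + 1 + int (length ?ys)) \<notin> {1, 2}"
        using content_no_bit[of "Suc q" T] pos_Suc[of q T] assms by simp
    qed (use content_token(2) assms set_tail_symbols in auto)
    moreover have "(?xs = ?ys) = (T ! q = T ! j)" using True token_inject by metis
    ultimately obtain m where m: "m \<le> length ?xs" "reach ?a (Suc (length ?xs)) (Cmp ps sg, pos T j + 1, v, ?a, pos T q + 1, Y, D)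
      (Cmp_Back ps sg (T ! q = T ! j), pos T j + int m, v, ?a, pos T q + int m, Y, D)" by auto
    have "reach ?a (Suc m) (Cmp_Back ps sg (T ! q = T ! j), pos T j + int m, v, ?a, pos T q + int m, Y, D)
      (Emit ps sg (T ! q = T ! j), pos T j, v, ?a, pos T q, Y, D)"
    proof (rule Cmp_Back_run)
      fix r assume r: "0 < r" "r \<le> m"
      then have "content T (pos T j + 1 + int (r - 1)) = ?xs ! (r - 1)" "?xs ! (r - 1) \<in> set ?xs"
        using content_token(2)[OF assms(1), of "r - 1"] m(1) by auto
      then show "content T (pos T j + int r) < 3" using set_tail_symbols[of "T ! j"] r by auto
    qed (use content_token(1)[OF assms(1)] head_symbol_range in simp)
    from reach_step[OF s reach_trans[OF m(2) this]] show ?thesis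
      by (rule reach_mono) (use m(1) tail_length[OF assms(1)] in simp)
  qed
qed

text \<open>The change from \<open>Second\<close> to \<open>Second_Marked\<close> in the middle of a
  sweep thus does not affect the blocks.\<close>

lemma exp_block_cong: "(ps = First) = (ps' = First) \<Longrightarrow> exp_block ps = exp_block ps'"
  by (auto simp: exp_block_def fun_eq_iff)

text \<open>In the second pass the first unmarked cell is met at \<open>q = j\<close>; marking it
  and changing to \<open>Second_Marked\<close> keeps later cells unmarked, hence the three cases for
  \<open>ps\<close>. The block shows the old parity while the cell receives the new one.\<close>

lemma Emit_run:
  assumes "j < length T" "q < length T" "g (T ! q) \<le> 1" "Y (pos T q) = g (T ! q)"
    and "D (pos T q) = (if q < j then 2 else 0)"
    and "ps = First \<or> ps = Second \<and> q \<le> j \<or> ps = Second_Marked \<and> j < q"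
  shows "reach (content T) (input_length T + 1)
     (Emit ps sg (T ! q = T ! j), pos T j, v, content T, pos T q, Y, D)
     (Cmp_Start (if ps = Second \<and> q = j then Second_Marked else ps) sg, pos T j,
       v @ map Suc (exp_block ps (T ! j) g j q (T ! q)), content T, pos T (Suc q),
       Y(pos T q := (if ps = First then g else next_parity (T ! j) g) (T ! q)),
       D(pos T q := (if q < (if ps = First then j else Suc j) then 2 else 0)))"
proof -
  let ?Y = "Y(pos T q := (if ps = First then g else next_parity (T ! j) g) (T ! q))"
  let ?D = "D(pos T q := (if q < (if ps = First then j else Suc j) then 2 else 0))"
  let ?v = "v @ map Suc (exp_block ps (T ! j) g j q (T ! q))"
  let ?ps = "if ps = Second \<and> q = j then Second_Marked else ps"
  have "g (T ! q) = 0 \<or> g (T ! q) = 1" using assms(3) by linarith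
  then have s: "macro_step (content T) (Emit ps sg (T ! q = T ! j), pos T j, v, content T, pos T q, Y, D) =
      (Next_B ?ps sg, pos T j, ?v, content T, pos T q + 1, ?Y, ?D)"
    using assms(4-6) content_token(1)[OF assms(1)]
    by (cases "T ! j" rule: head_symbol.cases) (auto simp: exp_block_def fun_eq_iff less_Suc_eq)
  have "reach (content T) (Suc (length (tail_symbols (T ! q)))) (Next_B ?ps sg, pos T j, ?v, content T, pos T q + 1, ?Y, ?D)
     (Cmp_Start ?ps sg, pos T j, ?v, content T, pos T q + 1 + int (length (tail_symbols (T ! q))), ?Y, ?D)"
  proof (rule Next_B_run)
    fix r assume "r < length (tail_symbols (T ! q))"
    then show "content T (pos T q + 1 + int r) \<in> {1, 2}"
      using content_token(2)[OF assms(2)] set_tail_symbols[of "T ! q"] by (auto dest: nth_mem)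
  next
    show "content T (pos T q + 1 + int (length (tail_symbols (T ! q)))) \<notin> {1, 2}"
      using content_no_bit[of "Suc q" T] pos_Suc[of q T] assms by simp
  qed
  from reach_step[OF s this] show ?thesis
    unfolding pos_Suc[OF assms(2)]
    by (rule reach_mono) (use tail_length[OF assms(2)] in simp)
qed

text \<open>Each cell is read before it is overwritten, so the cells from \<open>q\<close> on still
  carry the old values. The claim that cells before \<open>q\<close> stay unchanged preserves, in
  the induction, the update just made at \<open>q\<close>.\<close>

lemma sweep_run:
  assumes "j < length T" "q \<le> length T" "\<And>t. g t \<le> 1"
    and "\<And>r. q \<le> r \<Longrightarrow> r < length T \<Longrightarrow> Y (pos T r) = g (T ! r) \<and> D (pos T r) = (if r < j then 2 else 0)"
    and "ps = First \<or> ps = Second \<and> q \<le> j \<or> ps = Second_Marked \<and> j < q"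
  shows "\<exists>ps' Y' D'. (ps' = First \<longleftrightarrow> ps = First) \<and>
     reach (content T) (1 + (length T - q) * (3 * input_length T + 2))
       (Cmp_Start ps sg, pos T j, v, content T, pos T q, Y, D)
       (Rewind_B ps' sg, pos T j,
         v @ map Suc (concat (map (\<lambda>r. exp_block ps (T ! j) g j r (T ! r)) [q..<length T])),
         content T, int (input_length T) - 1, Y', D') \<and>
     (\<forall>r<q. Y' (pos T r) = Y (pos T r) \<and> D' (pos T r) = D (pos T r)) \<and>
     (\<forall>r. q \<le> r \<longrightarrow> r < length T \<longrightarrow>
        Y' (pos T r) = (if ps = First then g else next_parity (T ! j) g) (T ! r) \<and>
        D' (pos T r) = (if r < (if ps = First then j else Suc j) then 2 else 0))"
  using assms(2,4,5)
proof (induction "length T - q" arbitrary: q v ps Y D)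
  case 0
  then have q: "q = length T" by simp
  have "reach (content T) 1 (Cmp_Start ps sg, pos T j, v, content T, pos T q, Y, D)
     (Rewind_B ps sg, pos T j, v, content T, int (input_length T) - 1, Y, D)"
    unfolding One_nat_def by (rule reach_step[OF _ reach_refl]) (use content_end[of T] pos_length[of T] q in \<open>simp add: fun_upd_idem\<close>)
  then show ?case using q by (intro exI[of _ ps] exI[of _ Y] exI[of _ D]) simp
next
  case (Suc n)
  have q: "q < length T" using Suc(2) by simp
  let ?ps = "if ps = Second \<and> q = j then Second_Marked else ps"
  let ?Y = "Y(pos T q := (if ps = First then g else next_parity (T ! j) g) (T ! q))"
  let ?D = "D(pos T q := (if q < (if ps = First then j else Suc j) then 2 else 0))"
  let ?v = "v @ map Suc (exp_block ps (T ! j) g j q (T ! q))"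
  let ?f = "\<lambda>r. exp_block ps (T ! j) g j r (T ! r)"
  have ps: "(?ps = First) = (ps = First)" by auto
  have f: "(\<lambda>r. exp_block ?ps (T ! j) g j r (T ! r)) = ?f"
    using exp_block_cong[OF ps] by metis
  have pos: "pos T r \<noteq> pos T q" if "r \<noteq> q" "r < length T" for r
    using pos_inject[of r q T] that q by simp
  have "\<exists>ps' Y' D'. (ps' = First \<longleftrightarrow> ?ps = First) \<and>
     reach (content T) (1 + (length T - Suc q) * (3 * input_length T + 2))
       (Cmp_Start ?ps sg, pos T j, ?v, content T, pos T (Suc q), ?Y, ?D)
       (Rewind_B ps' sg, pos T j,
         ?v @ map Suc (concat (map (\<lambda>r. exp_block ?ps (T ! j) g j r (T ! r)) [Suc q..<length T])),
         content T, int (input_length T) - 1, Y', D') \<and>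
     (\<forall>r<Suc q. Y' (pos T r) = ?Y (pos T r) \<and> D' (pos T r) = ?D (pos T r)) \<and>
     (\<forall>r. Suc q \<le> r \<longrightarrow> r < length T \<longrightarrow>
        Y' (pos T r) = (if ?ps = First then g else next_parity (T ! j) g) (T ! r) \<and>
        D' (pos T r) = (if r < (if ?ps = First then j else Suc j) then 2 else 0))"
  proof (rule Suc(1))
    show "?Y (pos T r) = g (T ! r) \<and> ?D (pos T r) = (if r < j then 2 else 0)" if "Suc q \<le> r" "r < length T" for r
      using Suc(4)[of r] pos[of r] that by auto
  qed (use Suc(2,5) q in auto)
  then obtain ps' Y' D' where *: "ps' = First \<longleftrightarrow> ps = First"
     "reach (content T) (1 + (length T - Suc q) * (3 * input_length T + 2))
       (Cmp_Start ?ps sg, pos T j, ?v, content T, pos T (Suc q), ?Y, ?D)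
       (Rewind_B ps' sg, pos T j, ?v @ map Suc (concat (map ?f [Suc q..<length T])),
         content T, int (input_length T) - 1, Y', D')"
     "\<And>r. r < Suc q \<Longrightarrow> Y' (pos T r) = ?Y (pos T r) \<and> D' (pos T r) = ?D (pos T r)"
     "\<And>r. Suc q \<le> r \<Longrightarrow> r < length T \<Longrightarrow>
        Y' (pos T r) = (if ps = First then g else next_parity (T ! j) g) (T ! r) \<and>
        D' (pos T r) = (if r < (if ps = First then j else Suc j) then 2 else 0)"
    unfolding ps f by blast
  have "reach (content T) (input_length T + 1)
     (Emit ps sg (T ! q = T ! j), pos T j, v, content T, pos T q, Y, D)
     (Cmp_Start ?ps sg, pos T j, ?v, content T, pos T (Suc q), ?Y, ?D)"
    by (rule Emit_run) (use assms(1,3) q Suc(4)[of q] Suc(5) in auto)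
  from reach_trans[OF compare_run[OF assms(1) q] reach_trans[OF this *(2)]]
  have "reach (content T) (1 + (length T - q) * (3 * input_length T + 2))
       (Cmp_Start ps sg, pos T j, v, content T, pos T q, Y, D)
       (Rewind_B ps' sg, pos T j, ?v @ map Suc (concat (map ?f [Suc q..<length T])),
         content T, int (input_length T) - 1, Y', D')"
    by (rule reach_mono) (use q in \<open>simp add: Suc_diff_Suc[symmetric]\<close>)
  moreover have "?v @ map Suc (concat (map ?f [Suc q..<length T])) = v @ map Suc (concat (map ?f [q..<length T]))"
    using q by (simp add: upt_conv_Cons)
  moreover have "\<forall>r<q. Y' (pos T r) = Y (pos T r) \<and> D' (pos T r) = D (pos T r)"
    using *(3) pos q by auto
  moreover have "\<forall>r. q \<le> r \<longrightarrow> r < length T \<longrightarrow>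
        Y' (pos T r) = (if ps = First then g else next_parity (T ! j) g) (T ! r) \<and>
        D' (pos T r) = (if r < (if ps = First then j else Suc j) then 2 else 0)"
  proof (intro allI impI)
    fix r assume "q \<le> r" "r < length T"
    then show "Y' (pos T r) = (if ps = First then g else next_parity (T ! j) g) (T ! r) \<and>
        D' (pos T r) = (if r < (if ps = First then j else Suc j) then 2 else 0)"
      using *(3)[of r] *(4)[of r] by (cases "q = r") auto
  qed
  ultimately show ?case using *(1) by (intro exI[of _ ps'] exI[of _ Y'] exI[of _ D']) simp
qed

text \<open>For a constant, one step leaves the first symbol, four read the bits, four go back and
  one recognises the first symbol again. Other tokens take one step.\<close>

lemma Start_run:
  assumes "j < length T" "ps = First \<or> ps = Second"
  shows "reach (content T) 10 (Start ps sg, pos T j, v, B, k, Y, D)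
     (Cmp_Start ps (if ps = First then sg else next_sign (T ! j) sg), pos T j,
        v @ [4, coef_symbol (coef_sign ps (T ! j) sg)], B, k, Y, D)"
proof (cases "\<exists>A. T ! j = Some (Const A)")
  case True
  then obtain A where A: "T ! j = Some (Const A)" by blast
  let ?a = "content T" and ?p = "pos T j"
  have h: "?a ?p = 3" using content_token(1)[OF assms(1)] A by simp
  have c: "?a (?p + 1) = encode_entry (A $ 1 $ 1)" "?a (?p + 2) = encode_entry (A $ 1 $ 2)"
    "?a (?p + 3) = encode_entry (A $ 2 $ 1)" "?a (?p + 4) = encode_entry (A $ 2 $ 2)"
    using content_token(2)[OF assms(1), of 0] content_token(2)[OF assms(1), of 1]
      content_token(2)[OF assms(1), of 2] content_token(2)[OF assms(1), of 3] A
    by (simp_all add: add.assoc)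
  define b where "b x = (if encode_entry x = 2 then 1 else 0 :: nat)" for x
  have e: "\<not> 3 \<le> encode_entry x" "b x \<le> 1" for x by (auto simp: encode_entry_def b_def)
  define m1 where "m1 = 2 + b (A $ 1 $ 1)"
  define m2 where "m2 = 2 * m1 + b (A $ 1 $ 2)"
  define m3 where "m3 = 2 * m2 + b (A $ 2 $ 1)"
  define m4 where "m4 = 2 * m3 + b (A $ 2 $ 2)"
  have m: "m1 < 16" "m2 < 16" "m3 < 16" "\<not> m4 < 16"
    using e(2)[of "A $ 1 $ 1"] e(2)[of "A $ 1 $ 2"] e(2)[of "A $ 2 $ 1"] e(2)[of "A $ 2 $ 2"]
    by (auto simp: m1_def m2_def m3_def m4_def)
  have m1: "Suc (Suc (b (A $ 1 $ 1))) = m1" by (simp add: m1_def)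
  have code: "const_code A = m4"
    unfolding const_code_def m1_def m2_def m3_def m4_def b_def by simp
  let ?sg = "if ps = First then sg else sg = const_sign m4"
  let ?v = "v @ [4, coef_symbol (sg = const_coef ps m4)]"
  have s: "macro_step ?a (Start ps sg, ?p, v, B, k, Y, D) = (Read ps sg 1, ?p + 1, v, B, k, Y, D)"
    "macro_step ?a (Read ps sg 1, ?p + 1, v, B, k, Y, D) = (Read ps sg m1, ?p + 2, v, B, k, Y, D)"
    "macro_step ?a (Read ps sg m1, ?p + 2, v, B, k, Y, D) = (Read ps sg m2, ?p + 3, v, B, k, Y, D)"
    "macro_step ?a (Read ps sg m2, ?p + 3, v, B, k, Y, D) = (Read ps sg m3, ?p + 4, v, B, k, Y, D)"
    "macro_step ?a (Read ps sg m3, ?p + 4, v, B, k, Y, D) = (Rewind_A ps ?sg, ?p + 4, ?v, B, k, Y, D)"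
    "macro_step ?a (Rewind_A ps ?sg, ?p + 4, ?v, B, k, Y, D) = (Rewind_A ps ?sg, ?p + 3, ?v, B, k, Y, D)"
    "macro_step ?a (Rewind_A ps ?sg, ?p + 3, ?v, B, k, Y, D) = (Rewind_A ps ?sg, ?p + 2, ?v, B, k, Y, D)"
    "macro_step ?a (Rewind_A ps ?sg, ?p + 2, ?v, B, k, Y, D) = (Rewind_A ps ?sg, ?p + 1, ?v, B, k, Y, D)"
    "macro_step ?a (Rewind_A ps ?sg, ?p + 1, ?v, B, k, Y, D) = (Rewind_A ps ?sg, ?p, ?v, B, k, Y, D)"
    "macro_step ?a (Rewind_A ps ?sg, ?p, ?v, B, k, Y, D) = (Cmp_Start ps ?sg, ?p, ?v, B, k, Y, D)"
    using m m[unfolded m1_def] by (simp_all add: h c e Let_def b_def[symmetric] m1 m2_def[symmetric]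
        m3_def[symmetric] m4_def[symmetric])
  have "reach ?a (Suc (Suc (Suc (Suc (Suc (Suc (Suc (Suc (Suc (Suc 0)))))))))) (Start ps sg, ?p, v, B, k, Y, D)
      (Cmp_Start ps ?sg, ?p, ?v, B, k, Y, D)"
    by (rule s[THEN reach_step] reach_refl)+
  then show ?thesis by (cases "ps = First") (simp_all add: A code eval_nat_numeral)
next
  case False
  have "macro_step (content T) (Start ps sg, pos T j, v, B, k, Y, D) =
     (Cmp_Start ps (if ps = First then sg else next_sign (T ! j) sg), pos T j,
        v @ [4, coef_symbol (coef_sign ps (T ! j) sg)], B, k, Y, D)"
    using content_token(1)[OF assms(1)] False assms(2)
    by (cases "T ! j" rule: head_symbol.cases) auto
  from reach_mono[OF reach_step[OF this reach_refl[where n = 0]], of 10] show ?thesis by simp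
qed

section \<open>Processing one pass, one token, and all tokens\<close>

definition sweep_time :: "token list \<Rightarrow> nat" where
  "sweep_time T = length T * (3 * input_length T + 2) + input_length T + 12"

definition marks :: "token list \<Rightarrow> nat \<Rightarrow> (token \<Rightarrow> nat) \<Rightarrow> (int \<Rightarrow> nat) \<Rightarrow> (int \<Rightarrow> nat) \<Rightarrow> bool" where
  "marks T j g Y D \<longleftrightarrow> (\<forall>r<length T. Y (pos T r) = g (T ! r) \<and> D (pos T r) = (if r < j then 2 else 0))"

text \<open>The first pass leaves marks and sign alone and only the second advances them, so both
  monomials of a token are written with the data of the same prefix.\<close>

lemma pass_run:
  assumes "j < length T" "\<And>t. g t \<le> 1" "marks T j g Y D" "ps = First \<or> ps = Second"
  shows "\<exists>ps' Y' D'. (ps' = First \<longleftrightarrow> ps = First) \<and>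
     reach (content T) (sweep_time T - 1)
       (Start ps sg, pos T j, v, content T, 0, Y, D)
       (Rewind_B ps' (if ps = First then sg else next_sign (T ! j) sg), pos T j,
         v @ monomial_output T ps (T ! j) g sg j, content T, - 1, Y', D') \<and>
     marks T (if ps = First then j else Suc j) (if ps = First then g else next_parity (T ! j) g) Y' D'"
proof -
  let ?a = "content T" and ?v = "v @ [4, coef_symbol (coef_sign ps (T ! j) sg)]"
  let ?sg = "if ps = First then sg else next_sign (T ! j) sg"
  have 1: "reach ?a 10 (Start ps sg, pos T j, v, ?a, 0, Y, D) (Cmp_Start ps ?sg, pos T j, ?v, ?a, pos T 0, Y, D)"
    using Start_run[OF assms(1,4)] by simp
  obtain ps' Y' D' where 2: "ps' = First \<longleftrightarrow> ps = First"
     "reach ?a (1 + (length T - 0) * (3 * input_length T + 2))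
       (Cmp_Start ps ?sg, pos T j, ?v, ?a, pos T 0, Y, D)
       (Rewind_B ps' ?sg, pos T j, ?v @ map Suc (exp_vec T ps (T ! j) g j), ?a, int (input_length T) - 1, Y', D')"
     "marks T (if ps = First then j else Suc j) (if ps = First then g else next_parity (T ! j) g) Y' D'"
    using sweep_run[OF assms(1), of 0 g Y D ps ?sg ?v] assms(2-4) unfolding marks_def exp_vec_def by auto
  have 3: "reach ?a (input_length T)
     (Rewind_B ps' ?sg, pos T j, ?v @ map Suc (exp_vec T ps (T ! j) g j), ?a, int (input_length T) - 1, Y', D')
     (Rewind_B ps' ?sg, pos T j, ?v @ map Suc (exp_vec T ps (T ! j) g j), ?a, - 1, Y', D')"
    by (rule Rewind_B_run) (auto simp: content_zero_iff)
  \<comment> \<open>The 12 in \<open>sweep_time\<close> consists of ten steps to read the token, one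
    to detect the end of the copy, and one reserved for leaving \<open>Rewind_B\<close>.\<close>
  have "reach ?a (sweep_time T - 1) (Start ps sg, pos T j, v, ?a, 0, Y, D)
     (Rewind_B ps' ?sg, pos T j, ?v @ map Suc (exp_vec T ps (T ! j) g j), ?a, - 1, Y', D')"
    by (rule reach_mono[OF reach_trans[OF 1 reach_trans[OF 2(2) 3]]]) (simp add: sweep_time_def)
  then show ?thesis using 2 by (intro exI[of _ ps'] exI[of _ Y'] exI[of _ D']) (simp add: monomial_output_def)
qed

lemma token_run:
  assumes "j < length T" "\<And>t. g t \<le> 1" "marks T j g Y D"
  shows "\<exists>Y' D'. reach (content T) (2 * sweep_time T + input_length T + 1)
       (Next_A sg, pos T j, v, content T, 0, Y, D)
       (Next_A (next_sign (T ! j) sg), pos T (Suc j),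
         v @ monomial_output T First (T ! j) g sg j @ monomial_output T Second (T ! j) g sg j @
           (if T ! j = None then [5] else []), content T, 0, Y', D') \<and>
     marks T (Suc j) (next_parity (T ! j) g) Y' D'"
proof -
  let ?a = "content T" and ?t = "T ! j"
  let ?v1 = "v @ monomial_output T First ?t g sg j"
  let ?v2 = "?v1 @ monomial_output T Second ?t g sg j"
  let ?v3 = "?v2 @ (if ?t = None then [5] else [])"
  let ?sg = "next_sign ?t sg"
  have h: "?a (pos T j) = head_symbol ?t" "?a (- 1) = 0"
    using content_token(1)[OF assms(1)] by (auto simp: content_zero_iff)
  have h5: "head_symbol ?t = 5 \<longleftrightarrow> ?t = None" by (cases ?t rule: head_symbol.cases) auto
  have 0: "macro_step ?a (Next_A sg, pos T j, v, ?a, 0, Y, D) = (Start First sg, pos T j, v, ?a, 0, Y, D)"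
    using h head_symbol_range(1)[of ?t] by auto
  obtain Y1 D1 where 1: "reach ?a (sweep_time T - 1) (Start First sg, pos T j, v, ?a, 0, Y, D)
       (Rewind_B First sg, pos T j, ?v1, ?a, - 1, Y1, D1)" "marks T j g Y1 D1"
    using pass_run[OF assms(1-3), of First sg v] by auto
  have 2: "macro_step ?a (Rewind_B First sg, pos T j, ?v1, ?a, - 1, Y1, D1) = (Start Second sg, pos T j, ?v1, ?a, 0, Y1, D1)"
    using h by (simp add: fun_upd_idem)
  obtain ps Y2 D2 where 3: "ps \<noteq> First" "reach ?a (sweep_time T - 1) (Start Second sg, pos T j, ?v1, ?a, 0, Y1, D1)
       (Rewind_B ps ?sg, pos T j, ?v2, ?a, - 1, Y2, D2)" "marks T (Suc j) (next_parity ?t g) Y2 D2"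
    using pass_run[OF assms(1,2) 1(2), of Second sg ?v1] by auto
  have 4: "macro_step ?a (Rewind_B ps ?sg, pos T j, ?v2, ?a, - 1, Y2, D2) = (Next_A ?sg, pos T j + 1, ?v3, ?a, 0, Y2, D2)"
    using h h5 3(1) by (simp add: fun_upd_idem)
  have "reach ?a (length (tail_symbols ?t)) (Next_A ?sg, pos T j + 1, ?v3, ?a, 0, Y2, D2)
     (Next_A ?sg, pos T j + 1 + int (length (tail_symbols ?t)), ?v3, ?a, 0, Y2, D2)"
  proof (rule Next_A_run)
    fix r assume "r < length (tail_symbols ?t)"
    then show "?a (pos T j + 1 + int r) \<in> {1, 2}"
      using content_token(2)[OF assms(1)] set_tail_symbols[of ?t] by (auto dest: nth_mem)
  qed
  then have 5: "reach ?a (length (tail_symbols ?t)) (Next_A ?sg, pos T j + 1, ?v3, ?a, 0, Y2, D2)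
     (Next_A ?sg, pos T (Suc j), ?v3, ?a, 0, Y2, D2)"
    unfolding pos_Suc[OF assms(1)] .
  have "reach ?a (2 * sweep_time T + input_length T + 1) (Next_A sg, pos T j, v, ?a, 0, Y, D)
     (Next_A ?sg, pos T (Suc j), ?v3, ?a, 0, Y2, D2)"
    by (rule reach_mono[OF reach_step[OF 0 reach_trans[OF 1(1) reach_step[OF 2 reach_trans[OF 3(2) reach_step[OF 4 5]]]]]])
       (use tail_length[OF assms(1)] in \<open>simp add: sweep_time_def\<close>)
  then show ?thesis using 3(3) unfolding append_assoc by blast
qed

lemma next_parity_le: "(\<And>t. g t \<le> 1) \<Longrightarrow> next_parity t' g t \<le> 1"
  by (cases t' rule: head_symbol.cases) auto

lemma tokens_run:
  assumes "j \<le> length T" "\<And>t. g t \<le> 1" "marks T j g Y D"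
  shows "\<exists>i k Y' D'. reach (content T) (1 + (length T - j) * (2 * sweep_time T + input_length T + 1))
       (Next_A sg, pos T j, v, content T, 0, Y, D)
       (Halt, i, v @ output_from T j g sg (drop j T), content T, k, Y', D')"
  using assms
proof (induction "length T - j" arbitrary: j g Y D sg v)
  case 0
  then have "macro_step (content T) (Next_A sg, pos T j, v, content T, 0, Y, D) = (Halt, pos T j, v, content T, 0, Y, D)"
    using content_end[of T] by simp
  from reach_step[OF this reach_refl] 0 show ?case
    by (intro exI[of _ "pos T j"] exI[of _ 0] exI[of _ Y] exI[of _ D]) simp
next
  case (Suc n)
  then have j: "j < length T" by simp
  let ?v = "v @ monomial_output T First (T ! j) g sg j @ monomial_output T Second (T ! j) g sg j @
           (if T ! j = None then [5] else [])"
  obtain Y1 D1 where 1: "reach (content T) (2 * sweep_time T + input_length T + 1)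
       (Next_A sg, pos T j, v, content T, 0, Y, D)
       (Next_A (next_sign (T ! j) sg), pos T (Suc j), ?v, content T, 0, Y1, D1)"
     "marks T (Suc j) (next_parity (T ! j) g) Y1 D1"
    using token_run[OF j Suc(4,5)] by blast
  have "n = length T - Suc j" "Suc j \<le> length T" using Suc(2) j by auto
  from Suc(1)[OF this next_parity_le[OF Suc(4)] 1(2), of "next_sign (T ! j) sg" ?v]
  obtain i k Y' D' where 2: "reach (content T) (1 + (length T - Suc j) * (2 * sweep_time T + input_length T + 1))
       (Next_A (next_sign (T ! j) sg), pos T (Suc j), ?v, content T, 0, Y1, D1)
       (Halt, i, ?v @ output_from T (Suc j) (next_parity (T ! j) g) (next_sign (T ! j) sg) (drop (Suc j) T), content T, k, Y', D')"
    by blast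
  have "reach (content T) (1 + (length T - j) * (2 * sweep_time T + input_length T + 1))
       (Next_A sg, pos T j, v, content T, 0, Y, D)
       (Halt, i, ?v @ output_from T (Suc j) (next_parity (T ! j) g) (next_sign (T ! j) sg) (drop (Suc j) T), content T, k, Y', D')"
    by (rule reach_mono[OF reach_trans[OF 1(1) 2]]) (use j in \<open>simp add: Suc_diff_Suc[symmetric]\<close>)
  moreover have "drop j T = T ! j # drop (Suc j) T" using j by (simp add: Cons_nth_drop_Suc)
  ultimately show ?case by (metis append_assoc output_from.simps(2))
qed

section \<open>Copying the input, and the total running time\<close>

lemma Copy_run:
  fixes s :: "nat list"
  defines "out \<equiv> \<lambda>w. concat (map (\<lambda>x. if 3 \<le> x then [6, 6, 6, 6 :: nat] else []) w)"
  assumes "0 \<notin> set s" "n \<le> length s"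
  shows "reach (tape_content s) n (Copy, 0, [], \<lambda>_. 0, 0, \<lambda>_. 0, \<lambda>_. 0)
     (Copy, int n, out (take n s), tape_content (take n s), int n, \<lambda>_. 0, \<lambda>_. 0)"
  using assms(3)
proof (induction n)
  case 0
  have "tape_content [] = (\<lambda>_. 0)" by (auto simp: tape_content_def)
  then show ?case by (simp add: reach_refl out_def)
next
  case (Suc n)
  have n: "n < length s" using Suc by simp
  have "s ! n \<noteq> 0" using assms(2) n nth_mem by metis
  moreover have "tape_content s (int n) = s ! n" using n by (simp add: tape_content_def)
  moreover have "(tape_content (take n s))(int n := s ! n) = tape_content (take (Suc n) s)"
    using tape_content_snoc[of "take n s" "s ! n"] n by (simp add: take_Suc_conv_app_nth)
  moreover have "out (take (Suc n) s) = out (take n s) @ (if 3 \<le> s ! n then [6, 6, 6, 6] else [])"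
    using n by (simp add: out_def take_Suc_conv_app_nth)
  ultimately have "macro_step (tape_content s) (Copy, int n, out (take n s), tape_content (take n s), int n, \<lambda>_. 0, \<lambda>_. 0)
    = (Copy, int (Suc n), out (take (Suc n) s), tape_content (take (Suc n) s), int (Suc n), \<lambda>_. 0, \<lambda>_. 0)"
    by (simp add: fun_upd_idem)
  from reach_trans[OF Suc.IH reach_step[OF this reach_refl, of 0]] n show ?case by simp
qed

text \<open>Exactly one symbol of each token is at least 3, so the number of variables, four per
  token, is written in unary while copying.\<close>

lemma copy_output:
  "concat (map (\<lambda>x. if 3 \<le> x then [6, 6, 6, 6 :: nat] else []) (concat (map encode_token T)))
     = replicate (4 * length T) 6"
proof (induction T)
  case (Cons t T)
  have "concat (map (\<lambda>x. if 3 \<le> x then [6, 6, 6, 6 :: nat] else []) (tail_symbols t)) = []"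
    using set_tail_symbols[of t] by auto
  moreover have "replicate (4 * length (t # T)) (6 :: nat) = [6, 6, 6, 6] @ replicate (4 * length T) 6"
    by (simp add: eval_nat_numeral)
  ultimately show ?case using Cons head_symbol_range(1)[of t] by (simp only: encode_token_def concat.simps list.map map_append concat_append) simp
qed simp

lemma machine_run:
  "\<exists>i k Y D. reach (content T) (50 * (input_length T + 1) ^ 3) (Copy, 0, [], \<lambda>_. 0, 0, \<lambda>_. 0, \<lambda>_. 0)
     (Halt, i, replicate (4 * length T) 6 @ output_from T 0 (\<lambda>_. 0) True T, content T, k, Y, D)"
proof -
  let ?s = "concat (map encode_token T)" and ?L = "input_length T" and ?v = "replicate (4 * length T) (6 :: nat)"
  have nz: "0 \<notin> set ?s"
  proof
    assume "0 \<in> set ?s"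
    then obtain r where "r < ?L" "?s ! r = 0" unfolding input_length_def in_set_conv_nth by auto
    then show False using content_zero_iff[of T "int r"]
      by (simp add: content_def tape_content_def input_length_def del: length_concat)
  qed
  have 1: "reach (content T) ?L (Copy, 0, [], \<lambda>_. 0, 0, \<lambda>_. 0, \<lambda>_. 0)
     (Copy, int ?L, ?v, content T, int ?L, \<lambda>_. 0, \<lambda>_. 0)"
    using Copy_run[OF nz order_refl] copy_output[of T]
    by (simp add: content_def input_length_def del: length_concat map_concat)
  have 2: "macro_step (content T) (Copy, int ?L, ?v, content T, int ?L, \<lambda>_. 0, \<lambda>_. 0) =
     (Rewind_Both, int ?L - 1, ?v, content T, int ?L - 1, \<lambda>_. 0, \<lambda>_. 0)"
    using content_zero_iff[of T "int ?L"] by (simp add: fun_upd_idem)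
  have 3: "reach (content T) (Suc ?L) (Rewind_Both, int ?L - 1, ?v, content T, int ?L - 1, \<lambda>_. 0, \<lambda>_. 0)
     (Next_A True, 0, ?v, content T, 0, \<lambda>_. 0, \<lambda>_. 0)"
    by (rule Rewind_Both_run) (auto simp: content_zero_iff)
  obtain i k Y' D' where 4: "reach (content T) (1 + length T * (2 * sweep_time T + ?L + 1))
       (Next_A True, 0, ?v, content T, 0, \<lambda>_. 0, \<lambda>_. 0)
       (Halt, i, ?v @ output_from T 0 (\<lambda>_. 0) True T, content T, k, Y', D')"
    using tokens_run[of 0 T "\<lambda>_. 0" "\<lambda>_. 0" "\<lambda>_. 0" True ?v] by (auto simp: marks_def)
  \<comment> \<open>The bound is cubic: there are at most \<open>?L\<close> tokens, each with two
    sweeps over at most \<open>?L\<close> tokens, at linear cost per comparison.\<close>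
  have "?L + Suc (Suc ?L + (1 + length T * (2 * sweep_time T + ?L + 1))) \<le> 50 * (?L + 1) ^ 3"
  proof -
    have N: "length T \<le> ?L" by (rule length_le_input_length)
    have "sweep_time T \<le> ?L * (3 * ?L + 2) + ?L + 12"
      unfolding sweep_time_def using N by (intro add_mono mult_le_mono) auto
    then have "length T * (2 * sweep_time T + ?L + 1) \<le> ?L * (2 * (?L * (3 * ?L + 2) + ?L + 12) + ?L + 1)"
      using N by (intro mult_le_mono) auto
    also have "\<dots> + (2 * ?L + 3) \<le> 50 * (?L + 1) ^ 3"
      by (simp add: power3_eq_cube algebra_simps)
    finally show ?thesis by simp
  qed
  from reach_mono[OF reach_trans[OF 1 reach_step[OF 2 reach_trans[OF 3 4]]] this]
  show ?thesis by blast
qed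

section \<open>Matrices and the field with four elements\<close>

lemma three_cases: "t = 0 \<or> t = 1 \<or> t = (2 :: 3)"
  using exhaust_3[of t] by auto

definition mat22 :: "2 \<Rightarrow> 2 \<Rightarrow> 2 \<Rightarrow> 2 \<Rightarrow> mat2" where
  "mat22 a b c d = vector [vector [a, b], vector [c, d]]"

lemma mat22_nth [simp]:
  "mat22 a b c d $ 1 $ 1 = a" "mat22 a b c d $ 1 $ 2 = b"
  "mat22 a b c d $ 2 $ 1 = c" "mat22 a b c d $ 2 $ 2 = d"
  by (simp_all add: mat22_def)

lemma mat22_cases: obtains a b c d where "X = mat22 a b c d"
proof
  show "X = mat22 (X $ 1 $ 1) (X $ 1 $ 2) (X $ 2 $ 1) (X $ 2 $ 2)"
    by (simp add: vec_eq_iff forall_2)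
qed

lemma mat22_mult: "mat22 a b c d ** mat22 a' b' c' d' =
    mat22 (a * a' + b * c') (a * b' + b * d') (c * a' + d * c') (c * b' + d * d')"
  by (simp add: vec_eq_iff forall_2 matrix_matrix_mult_def sum_2)

lemma mat22_one: "mat 1 = mat22 1 0 0 1"
  by (simp add: vec_eq_iff forall_2 mat_def)

lemma mat22_eq_iff: "mat22 a b c d = mat22 a' b' c' d' \<longleftrightarrow> a = a' \<and> b = b' \<and> c = c' \<and> d = d'"
  by (auto simp: vec_eq_iff forall_2)

text \<open>The element \<alpha>^t\<beta>^e, with the sign \<open>s\<close> = (-1)^e in place of e,
  so that the product law becomes polynomial in \<open>t\<close> and \<open>s\<close>.\<close>

definition gl_elem :: "3 \<Rightarrow> 3 \<Rightarrow> mat2" where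
  "gl_elem t s = (if s = 1
     then (if t = 0 then mat22 1 0 0 1 else if t = 1 then mat22 0 1 1 1 else mat22 1 1 1 0)
     else (if t = 0 then mat22 0 1 1 0 else if t = 1 then mat22 1 0 1 1 else mat22 1 1 0 1))"

text \<open>Moving \<beta> past a power of \<alpha> inverts that power. All 36 pairs are
  checked.\<close>

lemma gl_elem_mult:
  assumes "s \<in> {-1, 1}" "s' \<in> {-1, 1}"
  shows "gl_elem t s ** gl_elem t' s' = gl_elem (t + s * t') (s * s')"
proof -
  have "s = - 1 \<or> s = 1" "s' = - 1 \<or> s' = 1" using assms by auto
  with three_cases[of t] three_cases[of t'] show ?thesis
    by (elim disjE) (simp_all only:, simp_all add: gl_elem_def mat22_mult mat22_eq_iff)
qed

lemma gl_elem_invertible: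
  assumes "s \<in> {-1, 1}"
  shows "invertible (gl_elem t s)"
proof -
  have "s * s = 1" "gl_elem 0 1 = mat 1" using assms by (auto simp: mat22_one gl_elem_def)
  then have "gl_elem t s ** gl_elem (- s * t) s = mat 1" "gl_elem (- s * t) s ** gl_elem t s = mat 1"
    using assms by (simp_all add: gl_elem_mult mult.assoc[symmetric])
  then show ?thesis unfolding invertible_def by blast
qed

text \<open>By multiplicativity, an inverse makes the determinant nonzero; of the sixteen matrices
  only the six listed in \<open>gl_elem\<close> remain.\<close>

lemma invertible_gl_elem:
  assumes "invertible X"
  obtains t s where "X = gl_elem t s" "s \<in> {-1, 1}"
proof -
  obtain a b c d where X: "X = mat22 a b c d" by (rule mat22_cases)
  obtain Y where "X ** Y = mat 1" using assms unfolding invertible_def by blast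
  moreover obtain a' b' c' d' where "Y = mat22 a' b' c' d'" by (rule mat22_cases)
  ultimately have e: "a * a' + b * c' = 1" "a * b' + b * d' = 0" "c * a' + d * c' = 0" "c * b' + d * d' = 1"
    unfolding X mat22_one by (auto simp: mat22_mult mat22_eq_iff)
  have "(a * d - b * c) * (a' * d' - b' * c') =
      (a * a' + b * c') * (c * b' + d * d') - (a * b' + b * d') * (c * a' + d * c')"
    by (simp add: algebra_simps)
  then have "a * d - b * c \<noteq> 0" using e by auto
  then have "\<exists>s. (s = - 1 \<or> s = 1) \<and> (X = gl_elem 0 s \<or> X = gl_elem 1 s \<or> X = gl_elem 2 s)"
    using bit_cases[of a] bit_cases[of b] bit_cases[of c] bit_cases[of d]
    unfolding ex_disj_distrib conj_disj_distribR X
    by (elim disjE) (simp_all add: gl_elem_def mat22_eq_iff)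
  then show thesis using that by blast
qed

section \<open>Words as products of group elements\<close>

definition sign_val :: "bool \<Rightarrow> 3" where
  "sign_val b = (if b then 1 else - 1)"

lemma sign_val_eq: "sign_val (b = c) = sign_val b * sign_val c"
  by (simp add: sign_val_def)

lemma sign_val_range: "sign_val b \<in> {-1, 1}"
  by (simp add: sign_val_def)

definition const_exp :: "mat2 \<Rightarrow> 3" where
  "const_exp A = sign_val (const_coef First (const_code A)) + sign_val (const_coef Second (const_code A))"

text \<open>Confirms the tables \<open>const_coef\<close> and \<open>const_sign\<close> on the six
  invertible matrices.\<close>

lemma const_gl_elem:
  assumes "invertible A"
  shows "A = gl_elem (const_exp A) (sign_val (const_sign (const_code A)))"
proof -
  obtain t s where "A = gl_elem t s" "s = - 1 \<or> s = 1" using invertible_gl_elem[OF assms] by blast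
  with three_cases[of t] show ?thesis
    by (elim disjE) (simp_all only:, simp_all add: gl_elem_def const_exp_def sign_val_def const_code_def const_coef_def const_sign_def encode_entry_def mat22_eq_iff)
qed

text \<open>Horner form of t_1 + y_1 t_2 + y_1 y_2 t_3 + ..., the exponent of \<alpha> in a product
  of group elements.\<close>

fun path_exp :: "(token \<Rightarrow> 3) \<Rightarrow> (token \<Rightarrow> 3) \<Rightarrow> token list \<Rightarrow> 3" where
  "path_exp \<tau> \<sigma> [] = 0"
| "path_exp \<tau> \<sigma> (t # ts) = \<tau> t + \<sigma> t * path_exp \<tau> \<sigma> ts"

text \<open>The terminator acts as a last factor: its exponent enters multiplied by the sign
  \<open>y\<close> of the whole word, which is the form that \<open>twist\<close> produces.\<close>

lemma word_value_gl_elem: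
  assumes "\<And>l. l \<in> set w \<Longrightarrow> letter_value x l = gl_elem (\<tau> (Some l)) (\<sigma> (Some l)) \<and> \<sigma> (Some l) \<in> {-1, 1}"
  obtains f y where "word_value x w = gl_elem f y" "y \<in> {-1, 1}"
    "path_exp \<tau> \<sigma> (map Some w @ [None]) = f + y * \<tau> None"
proof -
  have "\<exists>f y. word_value x w = gl_elem f y \<and> y \<in> {-1, 1} \<and>
    path_exp \<tau> \<sigma> (map Some w @ [None]) = f + y * \<tau> None"
    using assms
  proof (induction w)
    case Nil
    show ?case by (intro exI[of _ 0] exI[of _ 1]) (simp add: word_value_def mat22_one gl_elem_def)
  next
    case (Cons l w)
    then obtain f y where *: "word_value x w = gl_elem f y" "y \<in> {-1, 1}"
      "path_exp \<tau> \<sigma> (map Some w @ [None]) = f + y * \<tau> None" by fastforce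
    have l: "letter_value x l = gl_elem (\<tau> (Some l)) (\<sigma> (Some l))" "\<sigma> (Some l) \<in> {-1, 1}"
      using Cons(2)[of l] by auto
    have "word_value x (l # w) = gl_elem (\<tau> (Some l) + \<sigma> (Some l) * f) (\<sigma> (Some l) * y)"
      using *(1) l gl_elem_mult[OF l(2) *(2)] by (simp add: word_value_def)
    moreover have "\<sigma> (Some l) * y \<in> {-1, 1}" using l(2) *(2) by auto
    ultimately show ?case using *(3)
      by (intro exI[of _ "\<tau> (Some l) + \<sigma> (Some l) * f"] exI[of _ "\<sigma> (Some l) * y"])
         (simp add: algebra_simps)
  qed
  then show thesis using that by blast
qed

section \<open>Arithmetic in the field with four elements\<close>

locale four_element_field =
  fixes \<alpha> :: "'f::field"
  assumes card: "CARD('f) = 4" and primitive: "primitive_element \<alpha>"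
begin

lemma finite_field: "finite (UNIV :: 'f set)"
  using card card.infinite by fastforce

text \<open>Translation by 1 permutes the field, so summing over all elements gives 4 = 0, and 4 =
  (1 + 1)(1 + 1).\<close>

lemma two_zero: "1 + 1 = (0 :: 'f)"
proof -
  have "(\<Sum>x\<in>UNIV. x + 1) = (\<Sum>x\<in>UNIV. x :: 'f)"
    by (rule sum.reindex_bij_witness[of _ "\<lambda>x. x - 1" "\<lambda>x. x + 1"]) auto
  then have "of_nat 4 = (0 :: 'f)" using card by (simp add: sum.distrib)
  moreover have "of_nat 4 = (1 + 1) * (1 + 1 :: 'f)" by simp
  ultimately show ?thesis by (metis mult_eq_0_iff)
qed

lemma two_eq_0: "(2 :: 'f) = 0"
  using two_zero by simp

lemma add_self: "x + x = (0 :: 'f)"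
  using two_zero by (metis distrib_left mult.right_neutral mult_zero_right)

lemma alpha_ne: "\<alpha> \<noteq> 0" "\<alpha> \<noteq> 1"
proof -
  show "\<alpha> \<noteq> 0" using primitive by (simp add: primitive_element_def)
  show "\<alpha> \<noteq> 1"
  proof
    assume "\<alpha> = 1"
    then have "(UNIV :: 'f set) \<subseteq> {0, 1}" using primitive by (auto simp: primitive_element_def)
    then have "CARD('f) \<le> card {0, 1 :: 'f}" by (intro card_mono) auto
    then show False using card by simp
  qed
qed

text \<open>Multiplication by \<alpha> permutes the nonzero elements, so their product shows
  \<alpha>^3 = 1; cancelling \<alpha> - 1 leaves \<alpha>^2 + \<alpha> + 1 = 0.\<close>

lemma alpha_square: "\<alpha> * \<alpha> = \<alpha> + 1"
proof -
  let ?S = "UNIV - {0 :: 'f}"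
  have "(\<Prod>x\<in>?S. \<alpha> * x) = (\<Prod>x\<in>?S. x)"
    by (rule prod.reindex_bij_witness[of _ "\<lambda>x. x / \<alpha>" "\<lambda>x. \<alpha> * x"]) (use alpha_ne in auto)
  moreover have "card ?S = 3" using card finite_field by simp
  ultimately have "\<alpha> ^ 3 * (\<Prod>x\<in>?S. x) = (\<Prod>x\<in>?S. x)" by (simp add: prod.distrib)
  moreover have "(\<Prod>x\<in>?S. x) \<noteq> 0" using finite_field by simp
  ultimately have "\<alpha> ^ 3 = 1" by simp
  then have "(\<alpha> - 1) * (\<alpha> * \<alpha> + \<alpha> + 1) = 0" by (simp add: power3_eq_cube algebra_simps)
  then have "\<alpha> * \<alpha> + (\<alpha> + 1) = 0" using alpha_ne by (simp add: add.assoc)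
  then show ?thesis using add_self[of "\<alpha> + 1"] by (metis add_right_cancel)
qed

text \<open>The arguments beyond 0, 1, 2 are unreduced numerals that sums such as
  \<open>f + y * t\<close> produce in the case checks.\<close>

lemma power_mod3_simps:
  "power_mod3 \<alpha> 0 = 1" "power_mod3 \<alpha> 1 = \<alpha>" "power_mod3 \<alpha> 2 = \<alpha> + 1" "power_mod3 \<alpha> (- 1) = \<alpha> + 1"
  "power_mod3 \<alpha> 3 = 1" "power_mod3 \<alpha> 4 = \<alpha>" "power_mod3 \<alpha> (- 2) = \<alpha>"
proof -
  show 0: "power_mod3 \<alpha> 0 = 1" by (simp add: power_mod3_def bit1.Rep_0)
  show 1: "power_mod3 \<alpha> 1 = \<alpha>" by (simp add: power_mod3_def bit1.Rep_1)
  show *: "power_mod3 \<alpha> 2 = \<alpha> + 1"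
    by (simp add: power_mod3_def bit1.Rep_numeral power2_eq_square alpha_square)
  have "(- 1 :: 3) = 2" by simp
  then show "power_mod3 \<alpha> (- 1) = \<alpha> + 1" using * by metis
  have "(3 :: 3) = 0" "(4 :: 3) = 1" "(- 2 :: 3) = 1" by simp_all
  then show "power_mod3 \<alpha> 3 = 1" "power_mod3 \<alpha> 4 = \<alpha>" "power_mod3 \<alpha> (- 2) = \<alpha>"
    using 0 1 by metis+
qed

definition bit_val :: "2 \<Rightarrow> 'f" where
  "bit_val x = (if x = 0 then 0 else 1)"

lemma bit_val_add: "bit_val (x + y) = bit_val x + bit_val y"
  using bit_cases[of x] bit_cases[of y]
  by (elim disjE) (simp_all add: bit_val_def two_eq_0)

text \<open>The four sums of entries are the coordinates of \<open>X\<close> in the basis \<open>1, \<alpha>, \<beta>, \<alpha>\<beta>\<close> of the matrix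
  ring, so \<open>twist t\<close> is the additive map that sends \<open>\<alpha>\<^sup>f\<close> to \<open>\<alpha>\<^bsup>f+t\<^esup>\<close> and \<open>\<alpha>\<^sup>f\<beta>\<close> to \<open>\<alpha>\<^bsup>f-t\<^esup>\<close>.\<close>

definition twist :: "3 \<Rightarrow> mat2 \<Rightarrow> 'f" where
  "twist t X = bit_val (X $ 1 $ 1 + X $ 1 $ 2 + X $ 2 $ 1) * power_mod3 \<alpha> t
     + bit_val (X $ 1 $ 1 + X $ 2 $ 2) * power_mod3 \<alpha> (1 + t)
     + bit_val (X $ 1 $ 1 + X $ 1 $ 2 + X $ 2 $ 2) * power_mod3 \<alpha> (- t)
     + bit_val (X $ 1 $ 2 + X $ 2 $ 1) * power_mod3 \<alpha> (1 - t)"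

lemma twist_add: "twist t (X + Y) = twist t X + twist t Y"
  by (simp add: twist_def bit_val_add algebra_simps)

lemma twist_zero: "twist t 0 = 0"
  by (simp add: twist_def bit_val_def)

lemma twist_gl_elem:
  assumes "y \<in> {-1, 1}"
  shows "twist t (gl_elem f y) = power_mod3 \<alpha> (f + y * t)"
proof -
  have "y = - 1 \<or> y = 1" using assms by auto
  with three_cases[of t] three_cases[of f] show ?thesis
    by (elim disjE) (simp_all only:, simp_all add: add_self twist_def gl_elem_def bit_val_def power_mod3_simps two_eq_0 add.assoc[symmetric])
qed

text \<open>With A and B the parts of \<open>X\<close> along 1, \<alpha> and along \<beta>,
  \<alpha>\<beta>, read in the field, the hypothesis is A\<alpha>^t + B\<alpha>^(-t) = 0, and the
  two characters of \<open>t\<close> are linearly independent. The proof checks the sixteen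
  matrices.\<close>

lemma twist_eq_0:
  assumes "\<And>t. twist t X = 0"
  shows "X = 0"
proof -
  obtain a b c d where X: "X = mat22 a b c d" by (rule mat22_cases)
  have ne: "1 + \<alpha> \<noteq> 0" "\<alpha> + 1 \<noteq> 0"
    using alpha_ne(2) add_self[of 1] by (metis add_left_cancel, metis add_right_cancel)
  have "a = 0 \<and> b = 0 \<and> c = 0 \<and> d = 0"
    using assms[of 0] assms[of 1] assms[of 2] bit_cases[of a] bit_cases[of b] bit_cases[of c] bit_cases[of d]
   by (elim disjE) (simp_all add: alpha_ne ne add_self X twist_def bit_val_def power_mod3_simps two_eq_0 add.assoc[symmetric])
  then show ?thesis by (simp add: X vec_eq_iff forall_2)
qed

end

section \<open>The reduction\<close>

definition tokens :: "matrix_expr \<Rightarrow> token list" where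
  "tokens p = concat (map (\<lambda>w. map Some w @ [None]) p)"

lemma encode_letter_token: "encode_letter l = encode_token (Some l)"
  by (cases l) (simp_all add: encode_token_def)

lemma encode_expr_tokens: "encode_expr p = concat (map encode_token (tokens p))"
proof -
  have "concat (map encode_letter w) @ [5] = concat (map encode_token (map Some w @ [None]))" for w
    by (induction w) (simp_all add: encode_letter_token, simp add: encode_token_def)
  then show ?thesis unfolding encode_expr_def tokens_def
    by (induction p) simp_all
qed

text \<open>The polynomial that \<open>output_from\<close> writes for one word; \<open>T\<close>
  stays the whole expression because every monomial has exponents for all its tokens.\<close>

fun word_poly :: "token list \<Rightarrow> nat \<Rightarrow> (token \<Rightarrow> nat) \<Rightarrow> bool \<Rightarrow> token list \<Rightarrow> expanded_poly" where
  "word_poly T j g sg [] = []"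
| "word_poly T j g sg (t # ts) =
     (sign_val (coef_sign First t sg), exp_vec T First t g j) #
     (sign_val (coef_sign Second t sg), exp_vec T Second t g j) #
     word_poly T (Suc j) (next_parity t g) (next_sign t sg) ts"

fun expr_polys :: "token list \<Rightarrow> nat \<Rightarrow> matrix_expr \<Rightarrow> expanded_poly list" where
  "expr_polys T j [] = []"
| "expr_polys T j (w # p) =
     word_poly T j (\<lambda>_. 0) True (map Some w @ [None]) # expr_polys T (j + Suc (length w)) p"

definition reduction :: "matrix_expr \<Rightarrow> nat \<times> expanded_poly list" where
  "reduction p = (4 * length (tokens p), expr_polys (tokens p) 0 p)"

lemma coef_symbol_sign_val: "nat (Rep_bit1 (sign_val b)) + 1 = coef_symbol b"
proof -
  have "(- 1 :: 3) = 2" by simp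
  moreover have "Rep_bit1 (2 :: 3) = 2" by (simp add: bit1.Rep_numeral)
  ultimately have "Rep_bit1 (- 1 :: 3) = 2" by (simp only:)
  then show ?thesis by (simp add: sign_val_def coef_symbol_def bit1.Rep_1)
qed

text \<open>The terminator writes 5 and resets parities and sign, so the output splits at word
  boundaries whatever \<open>g\<close> and \<open>sg\<close> are.\<close>

lemma output_from_word:
  "output_from T j g sg (map Some w @ None # ts) =
     encode_expanded_poly (word_poly T j g sg (map Some w @ [None])) @
     output_from T (j + Suc (length w)) (\<lambda>_. 0) True ts"
proof (induction w arbitrary: j g sg)
  case Nil
  show ?case
    by (simp add: encode_expanded_poly_def monomial_output_def coef_symbol_sign_val[unfolded Suc_eq_plus1[symmetric]])
next
  case (Cons l w)
  then show ?case
    by (simp add: encode_expanded_poly_def monomial_output_def coef_symbol_sign_val[unfolded Suc_eq_plus1[symmetric]])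
qed

lemma output_from_tokens:
  "output_from T j (\<lambda>_. 0) True (tokens p) = concat (map encode_expanded_poly (expr_polys T j p))"
proof (induction p arbitrary: j)
  case (Cons w p)
  have "tokens (w # p) = map Some w @ None # tokens p" by (simp add: tokens_def)
  then show ?case using Cons by (simp only: output_from_word) simp
qed (simp add: tokens_def)

section \<open>Range and distinctness of the exponent vectors\<close>

lemma concat_blocks_nth:
  assumes "\<And>x. x \<in> set xs \<Longrightarrow> length (f x) = 4" "r < length xs" "c < 4"
  shows "concat (map f xs) ! (4 * r + c) = f (xs ! r) ! c"
  using assms
proof (induction xs arbitrary: r)
  case (Cons x xs)
  show ?case
  proof (cases r)
    case 0
    then show ?thesis using Cons.prems by (simp add: nth_append)
  next
    case (Suc r')
    then have "4 * r + c = length (f x) + (4 * r' + c)" using Cons.prems by simp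
    then show ?thesis using Cons Suc by (simp add: nth_append)
  qed
qed simp

lemma exp_vec_length: "length (exp_vec T ps t g j) = 4 * length T"
  by (simp add: exp_vec_def exp_block_def length_concat o_def sum_list_triv)

lemma exp_vec_nth:
  "r < length T \<Longrightarrow> c < 4 \<Longrightarrow> exp_vec T ps t g j ! (4 * r + c) = exp_block ps t g j r (T ! r) ! c"
  unfolding exp_vec_def by (subst concat_blocks_nth) (auto simp: exp_block_def)

lemma token_exponent_range: "token_exponent t \<in> {1, 2}"
  by (cases t rule: head_symbol.cases) auto

lemma exp_vec_range: "(\<And>t. g t \<le> 1) \<Longrightarrow> set (exp_vec T ps t g j) \<subseteq> {0, 1, 2}"
proof -
  assume "\<And>t. g t \<le> 1"
  then have "g t' \<in> {0, 1, 2}" for t' by (metis One_nat_def insertCI le_Suc_eq le_zero_eq)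
  then have "set (exp_block ps t g j r t') \<subseteq> {0, 1, 2}" for r t'
    using token_exponent_range[of t] by (auto simp: exp_block_def)
  then show ?thesis by (fastforce simp: exp_vec_def)
qed

text \<open>Separates the monomials of different tokens: those of token \<open>i\<close> itself have
  exponent 0 at this place.\<close>

lemma word_poly_marker:
  assumes "i < j" "i < length T" "(c, e) \<in> set (word_poly T j g sg ts)"
  shows "e ! (4 * i + 3) = 2"
  using assms
proof (induction ts arbitrary: j g sg)
  case (Cons t ts)
  have "exp_vec T ps t g j ! (4 * i + 3) = 2" for ps
    using exp_vec_nth[of i T 3 ps t g j] Cons.prems(1,2) by (simp add: exp_block_def)
  then show ?case using Cons.IH[of "Suc j"] Cons.prems by auto
qed simp

lemma word_poly_expanded:
  assumes "\<And>t. g t \<le> 1" "j + length ts \<le> length T" "\<And>i. i < length ts \<Longrightarrow> T ! (j + i) = ts ! i"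
  shows "word_poly T j g sg ts \<in> expanded_polys (4 * length T)"
  using assms
proof (induction ts arbitrary: j g sg)
  case (Cons t ts)
  let ?p = "word_poly T (Suc j) (next_parity t g) (next_sign t sg) ts"
  have j: "j < length T" "T ! j = t" using Cons.prems(2) Cons.prems(3)[of 0] by auto
  have IH: "?p \<in> expanded_polys (4 * length T)"
  proof (rule Cons.IH)
    show "T ! (Suc j + i) = ts ! i" if "i < length ts" for i using Cons.prems(3)[of "Suc i"] that by simp
  qed (use Cons.prems next_parity_le in auto)
  have "exp_vec T ps t g j ! (4 * j + 3) = 0" for ps
    using exp_vec_nth[of j T 3 ps t g j] j by (simp add: exp_block_def)
  then have new: "exp_vec T ps t g j \<notin> snd ` set ?p" for ps
    using word_poly_marker[of j "Suc j" T] j by force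
  \<comment> \<open>The two monomials of one token differ in the second entry of its own
    block.\<close>
  have "exp_vec T First t g j ! (4 * j + 1) \<noteq> 0" "exp_vec T Second t g j ! (4 * j + 1) = 0"
    using exp_vec_nth[of j T 1 _ t g j] j token_exponent_range[of t] by (auto simp: exp_block_def)
  then have "exp_vec T First t g j \<noteq> exp_vec T Second t g j" by metis
  moreover have "sign_val b \<noteq> 0" for b by (simp add: sign_val_def)
  ultimately show ?case
    using IH new exp_vec_length exp_vec_range[OF Cons.prems(1)]
    by (auto simp: expanded_polys_def)
qed (simp add: expanded_polys_def)

lemma expr_polys_expanded:
  assumes "drop j T = tokens p" "j \<le> length T"
  shows "set (expr_polys T j p) \<subseteq> expanded_polys (4 * length T)"
  using assms
proof (induction p arbitrary: j)
  case (Cons w p)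
  let ?ts = "map Some w @ [None]"
  have d: "drop j T = ?ts @ tokens p" using Cons.prems by (simp add: tokens_def)
  then have l: "j + length ?ts \<le> length T"
    using Cons.prems(2) by (metis add_le_cancel_left le_add1 le_add_diff_inverse length_append length_drop)
  have "word_poly T j (\<lambda>_. 0) True ?ts \<in> expanded_polys (4 * length T)"
  proof (rule word_poly_expanded[OF _ l])
    show "T ! (j + i) = ?ts ! i" if "i < length ?ts" for i
      using that d nth_drop[of j T i] Cons.prems(2) by (auto simp: nth_append less_Suc_eq)
  qed simp
  moreover have "set (expr_polys T (j + Suc (length w)) p) \<subseteq> expanded_polys (4 * length T)"
  proof (rule Cons.IH)
    have "drop (length ?ts) (drop j T) = tokens p" unfolding d by simp
    then show "drop (j + Suc (length w)) T = tokens p" by (simp add: add.commute)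
  qed (use l in simp)
  ultimately show ?case by simp
qed simp

lemma reduction_instance: "reduction p \<in> instances (exp_sum_problem \<alpha>)"
  using expr_polys_expanded[of 0 "tokens p" p] by (simp add: reduction_def exp_sum_problem_def)

section \<open>Values of the polynomials at sign vectors\<close>

lemma prod_blocks:
  fixes h :: "nat \<Rightarrow> 'a::comm_monoid_mult"
  shows "(\<Prod>i<4 * n. h i) = (\<Prod>r<n. h (4 * r) * h (4 * r + 1) * h (4 * r + 2) * h (4 * r + 3))"
  by (induction n) (simp_all add: mult_ac eval_nat_numeral)

text \<open>Each occurrence of a token has its own four variables; the value of the token is the product
  over its occurrences. This spares the machine the search for a canonical occurrence.\<close>

definition merged :: "token list \<Rightarrow> 3 list \<Rightarrow> nat \<Rightarrow> token \<Rightarrow> 3" where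
  "merged T a c t = (\<Prod>r<length T. if T ! r = t then a ! (4 * r + c) else 1)"

text \<open>Collecting the occurrences of each token gives the product of the merged signs with
  exponents \<open>g\<close>, the contribution of the variables to the sign of the prefix read so
  far.\<close>

definition parity_val :: "token list \<Rightarrow> 3 list \<Rightarrow> (token \<Rightarrow> nat) \<Rightarrow> 3" where
  "parity_val T a g = (\<Prod>r<length T. (a ! (4 * r)) ^ g (T ! r))"

fun tau :: "token list \<Rightarrow> 3 list \<Rightarrow> token \<Rightarrow> 3" where
  "tau T a (Some (Const A)) = const_exp A"
| "tau T a t = merged T a 1 t + merged T a 2 t"

fun sigma :: "token list \<Rightarrow> 3 list \<Rightarrow> token \<Rightarrow> 3" where
  "sigma T a (Some (Const A)) = sign_val (const_sign (const_code A))"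
| "sigma T a t = merged T a 0 t"

context
  fixes T :: "token list" and a :: "3 list"
  assumes len: "length a = 4 * length T" and signs: "set a \<subseteq> {-1, 1}"
begin

lemma entry_sign: "i < 4 * length T \<Longrightarrow> a ! i = - 1 \<or> a ! i = 1"
  using len subsetD[OF signs nth_mem[of i a]] by auto

lemma merged_sign: "c < 4 \<Longrightarrow> merged T a c t \<in> {-1, 1}"
proof -
  assume c: "c < 4"
  have "(\<Prod>r<n. if T ! r = t then a ! (4 * r + c) else 1) \<in> {-1, 1}" if "n \<le> length T" for n
    using that
  proof (induction n)
    case (Suc n)
    then show ?case using entry_sign[of "4 * n + c"] c by auto
  qed simp
  then show ?thesis by (simp add: merged_def)
qed

lemma sigma_sign: "sigma T a t \<in> {-1, 1}"
  using merged_sign[of 0] sign_val_range by (cases t rule: head_symbol.cases) auto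

text \<open>The marks in the last entries and the exponents 2 of constants are even and vanish on
  signs. The first entries give the prefix sign, and the column of the pass gives the merged unknown
  of the token.\<close>

lemma exp_vec_value:
  "(\<Prod>i<length a. a ! i ^ (exp_vec T ps t g j ! i)) =
     parity_val T a g *
     (case t of Some (Const A) \<Rightarrow> 1 | _ \<Rightarrow> merged T a (if ps = First then 1 else 2) t)"
proof -
  let ?e = "exp_vec T ps t g j"
  let ?c = "if ps = First then 1 else 2 :: nat"
  have block: "a ! (4 * r) ^ (?e ! (4 * r)) * a ! (4 * r + 1) ^ (?e ! (4 * r + 1)) *
      a ! (4 * r + 2) ^ (?e ! (4 * r + 2)) * a ! (4 * r + 3) ^ (?e ! (4 * r + 3)) =
      a ! (4 * r) ^ g (T ! r) * (if T ! r = t then a ! (4 * r + ?c) ^ token_exponent t else 1)"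
    if r: "r < length T" for r
  proof -
    have sq: "a ! (4 * r + 3) ^ 2 = 1" using entry_sign[of "4 * r + 3"] r by auto
    have "?e ! (4 * r) = g (T ! r)" "?e ! (4 * r + 1) = (if ps = First \<and> T ! r = t then token_exponent t else 0)"
      "?e ! (4 * r + 2) = (if ps \<noteq> First \<and> T ! r = t then token_exponent t else 0)"
      "?e ! (4 * r + 3) = (if r < j then 2 else 0)"
      using exp_vec_nth[OF r, of 0 ps t g j] exp_vec_nth[OF r, of 1 ps t g j]
        exp_vec_nth[OF r, of 2 ps t g j] exp_vec_nth[OF r, of 3 ps t g j]
      by (simp_all add: exp_block_def)
    then show ?thesis using sq by auto
  qed
  have "(\<Prod>i<length a. a ! i ^ (?e ! i)) =
      (\<Prod>r<length T. a ! (4 * r) ^ g (T ! r) * (if T ! r = t then a ! (4 * r + ?c) ^ token_exponent t else 1))"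
    unfolding len prod_blocks by (rule prod.cong[OF refl]) (simp only: lessThan_iff block)
  also have "\<dots> = parity_val T a g * (\<Prod>r<length T. if T ! r = t then a ! (4 * r + ?c) ^ token_exponent t else 1)"
    by (simp add: prod.distrib parity_val_def)
  also have "(\<Prod>r<length T. if T ! r = t then a ! (4 * r + ?c) ^ token_exponent t else 1) =
      (case t of Some (Const A) \<Rightarrow> 1 | _ \<Rightarrow> merged T a ?c t)"
  proof (cases "\<exists>A. t = Some (Const A)")
    case True
    have "a ! (4 * r + ?c) ^ 2 = 1" if "r < length T" for r
      using entry_sign[of "4 * r + ?c"] that by auto
    then show ?thesis using True by (auto intro!: prod.neutral)
  next
    case False
    then show ?thesis by (cases t rule: head_symbol.cases) (auto simp: merged_def intro!: prod.cong)
  qed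
  finally show ?thesis .
qed

text \<open>The entries are signs, so raising an exponent from 1 to 2 amounts to resetting it to
  0.\<close>

lemma parity_val_next:
  assumes "\<And>t. g t \<le> 1"
  shows "parity_val T a (next_parity (Some (Var i)) g) = parity_val T a g * merged T a 0 (Some (Var i))"
  unfolding parity_val_def merged_def prod.distrib[symmetric]
proof (rule prod.cong[OF refl])
  fix r assume "r \<in> {..<length T}"
  then have "a ! (4 * r) = - 1 \<or> a ! (4 * r) = 1" using entry_sign[of "4 * r"] by simp
  moreover have "g (T ! r) = 0 \<or> g (T ! r) = 1" using assms[of "T ! r"] by linarith
  ultimately show "a ! (4 * r) ^ next_parity (Some (Var i)) g (T ! r) =
      a ! (4 * r) ^ g (T ! r) * (if T ! r = Some (Var i) then a ! (4 * r + 0) else 1)"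
    by (cases "T ! r = Some (Var i)") auto
qed

text \<open>The prefix sign \<open>sign_val sg * parity_val T a g\<close> factors out of all further
  monomials, and the two monomials of the next token add up to this sign times \<open>tau\<close>;
  the rest is Horner's scheme.\<close>

lemma word_poly_value:
  assumes "\<And>t. g t \<le> 1"
  shows "expanded_poly_value a (word_poly T j g sg (map Some w @ [None])) =
     sign_val sg * parity_val T a g * path_exp (tau T a) (sigma T a) (map Some w @ [None])"
  using assms
proof (induction w arbitrary: j g sg)
  case Nil
  show ?case by (simp add: expanded_poly_value_def exp_vec_value algebra_simps)
next
  case (Cons l w)
  have IH: "expanded_poly_value a (word_poly T (Suc j) (next_parity (Some l) g) (next_sign (Some l) sg) (map Some w @ [None])) =
     sign_val (next_sign (Some l) sg) * parity_val T a (next_parity (Some l) g) *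
       path_exp (tau T a) (sigma T a) (map Some w @ [None])"
    by (rule Cons.IH) (rule next_parity_le[OF Cons.prems])
  show ?case
  proof (cases l)
    case (Var i)
    then show ?thesis
      using IH parity_val_next[OF Cons.prems, of i]
      by (simp add: expanded_poly_value_def exp_vec_value algebra_simps del: next_parity.simps)
  next
    case (Const A)
    then show ?thesis
      using IH
      by (simp add: expanded_poly_value_def exp_vec_value sign_val_eq const_exp_def algebra_simps)
  qed
qed

lemma expr_polys_value:
  "map (expanded_poly_value a) (expr_polys T j p) =
     map (\<lambda>w. path_exp (tau T a) (sigma T a) (map Some w @ [None])) p"
  by (induction p arbitrary: j) (simp_all add: word_poly_value parity_val_def sign_val_def)

end

section \<open>Correctness of the reduction\<close>

context four_element_field
begin

text \<open>The values of \<open>x\<close> are tied to \<open>a\<close> only for variables occurring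
  in \<open>p\<close>, so that the converse direction can start from an arbitrary \<open>x\<close>.
  The exponent of the terminator becomes the parameter of \<open>twist\<close>.\<close>

lemma exp_sum_eq_twist:
  assumes "p \<in> restricted_exprs" "length a = 4 * length (tokens p)" "set a \<subseteq> {-1, 1}"
    and x: "\<And>i. Some (Var i) \<in> set (tokens p) \<Longrightarrow>
      x i = gl_elem (tau (tokens p) a (Some (Var i))) (sigma (tokens p) a (Some (Var i)))"
  shows "(\<Sum>i<length (expr_polys (tokens p) 0 p).
      power_mod3 \<alpha> (expanded_poly_value a (expr_polys (tokens p) 0 p ! i))) =
     twist (tau (tokens p) a None) (expr_value x p)"
proof -
  let ?T = "tokens p"
  let ?ps = "expr_polys ?T 0 p" and ?f = "\<lambda>w. path_exp (tau ?T a) (sigma ?T a) (map Some w @ [None])"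
  have "(\<Sum>i<length ?ps. power_mod3 \<alpha> (expanded_poly_value a (?ps ! i))) =
      sum_list (map (power_mod3 \<alpha>) (map (expanded_poly_value a) ?ps))"
    by (simp add: sum_list_sum_nth atLeast0LessThan)
  also have "\<dots> = (\<Sum>w\<leftarrow>p. power_mod3 \<alpha> (?f w))"
    unfolding expr_polys_value[OF assms(2,3)] by (simp add: o_def)
  also have "\<dots> = (\<Sum>w\<leftarrow>p. twist (tau ?T a None) (word_value x w))"
  proof -
    have "power_mod3 \<alpha> (?f w) = twist (tau ?T a None) (word_value x w)" if w: "w \<in> set p" for w
    proof -
      have "letter_value x l = gl_elem (tau ?T a (Some l)) (sigma ?T a (Some l)) \<and> sigma ?T a (Some l) \<in> {-1, 1}"
        if l: "l \<in> set w" for l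
      proof (cases l)
        case (Var i)
        then have "Some (Var i) \<in> set ?T" using w l by (auto simp: tokens_def)
        then show ?thesis using x[of i] sigma_sign[OF assms(2,3)] Var by (simp del: tau.simps sigma.simps)
      next
        case (Const A)
        then have "invertible A" using assms(1) w l unfolding restricted_exprs_def by auto
        then show ?thesis using const_gl_elem[of A] Const sign_val_range by simp
      qed
      from word_value_gl_elem[OF this] obtain f y where "word_value x w = gl_elem f y" "y \<in> {-1, 1}"
        "?f w = f + y * tau ?T a None" by blast
      then show ?thesis by (simp add: twist_gl_elem)
    qed
    then show ?thesis by (intro arg_cong[where f = sum_list] map_cong) auto
  qed
  also have "\<dots> = twist (tau ?T a None) (expr_value x p)"
  proof -
    have "(\<Sum>w\<leftarrow>q. twist s (word_value x w)) = twist s (\<Sum>w\<leftarrow>q. word_value x w)" for q s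
      by (induction q) (simp_all add: twist_zero twist_add)
    then show ?thesis by (simp add: expr_value_def)
  qed
  finally show ?thesis .
qed

end

text \<open>The desired value is placed at the first occurrence of each token and 1 at all later
  ones.\<close>

lemma merged_prescribed:
  fixes F :: "token \<Rightarrow> nat \<Rightarrow> 3"
  assumes "t \<in> set T" "c < 4"
  shows "merged T (concat (map (\<lambda>r. map (\<lambda>c. if T ! r \<in> set (take r T) then 1 else F (T ! r) c) [0..<4]) [0..<length T])) c t = F t c"
proof -
  let ?f = "\<lambda>r. map (\<lambda>c. if T ! r \<in> set (take r T) then 1 else F (T ! r) c) [0..<4]"
  obtain r0 where r0: "r0 < length T" "T ! r0 = t" "\<And>r. r < r0 \<Longrightarrow> T ! r \<noteq> t"
  proof -
    define r0 where "r0 = (LEAST r. r < length T \<and> T ! r = t)"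
    have "\<exists>r. r < length T \<and> T ! r = t" using assms(1) by (simp add: in_set_conv_nth)
    then have "r0 < length T \<and> T ! r0 = t" unfolding r0_def by (rule LeastI_ex)
    moreover have "T ! r \<noteq> t" if "r < r0" for r
      using not_less_Least[of r "\<lambda>r. r < length T \<and> T ! r = t"] that calculation unfolding r0_def by auto
    ultimately show thesis using that by blast
  qed
  have "(if T ! r = t then concat (map ?f [0..<length T]) ! (4 * r + c) else 1) = (if r = r0 then F t c else 1)"
    if r: "r < length T" for r
  proof -
    have "concat (map ?f [0..<length T]) ! (4 * r + c) = ?f r ! c"
      using concat_blocks_nth[of "[0..<length T]" ?f r c] r assms(2) by simp
    also have "\<dots> = (if T ! r \<in> set (take r T) then 1 else F (T ! r) c)" using assms(2) by simp
    finally have e: "concat (map ?f [0..<length T]) ! (4 * r + c) = (if T ! r \<in> set (take r T) then 1 else F (T ! r) c)" .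
    show ?thesis
    proof (cases "r = r0")
      case True
      then have "T ! r \<notin> set (take r T)" using r0 by (auto simp: in_set_conv_nth)
      then show ?thesis using e True r0 by simp
    next
      case False
      have "T ! r \<in> set (take r T)" if "T ! r = t"
      proof -
        have "r0 < r" using False r0(3)[of r] that by linarith
        then show ?thesis using r0 r that by (metis in_set_conv_nth length_take min.absorb4 nth_take)
      qed
      then show ?thesis using e False by auto
    qed
  qed
  then have "merged T (concat (map ?f [0..<length T])) c t = (\<Prod>r<length T. if r = r0 then F t c else 1)"
    unfolding merged_def by (intro prod.cong) auto
  then show ?thesis using r0(1) by (simp add: prod.delta)
qed

lemma sum_of_signs: "\<exists>u v. (t :: 3) = u + v \<and> u \<in> {-1, 1} \<and> v \<in> {-1, 1}"
proof -
  have "(0 :: 3) = 1 + - 1" "(1 :: 3) = - 1 + - 1" "(2 :: 3) = 1 + 1" by simp_all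
  then show ?thesis using three_cases[of t] by blast
qed

context four_element_field
begin

lemma reduction_correct:
  assumes p: "p \<in> restricted_exprs"
  shows "holds restricted_equivalence_problem p \<longleftrightarrow> holds (exp_sum_problem \<alpha>) (reduction p)"
proof -
  let ?T = "tokens p" and ?ps = "expr_polys (tokens p) 0 p"
  let ?sum = "\<lambda>a. \<Sum>i<length ?ps. power_mod3 \<alpha> (expanded_poly_value a (?ps ! i))"
  have "?sum a = 0" if A: "\<And>x. (\<And>i. invertible (x i)) \<Longrightarrow> expr_value x p = 0"
    and a: "length a = 4 * length ?T" "set a \<subseteq> {-1, 1}" for a
  proof -
    \<comment> \<open>Every sign vector yields invertible matrices, so the hypothesis on
      \<open>p\<close> applies to them.\<close>
    define x where "x i = gl_elem (tau ?T a (Some (Var i))) (sigma ?T a (Some (Var i)))" for i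
    have "expr_value x p = 0" by (rule A) (metis x_def gl_elem_invertible sigma_sign[OF a])
    then show ?thesis using exp_sum_eq_twist[OF p a, of x] by (simp add: x_def twist_zero)
  qed
  moreover have "expr_value x p = 0"
    if B: "\<And>a. length a = 4 * length ?T \<Longrightarrow> set a \<subseteq> {-1, 1} \<Longrightarrow> ?sum a = 0"
      and x: "\<And>i. invertible (x i)" for x
  \<comment> \<open>Without words there is no terminator whose exponent could be made
    \<open>t\<close>, but the value is then an empty sum.\<close>
  proof (cases "p = []")
    case True
    then show ?thesis by (simp add: expr_value_def)
  next
    case False
    show ?thesis
    proof (rule twist_eq_0)
      fix t
      have "\<forall>i. \<exists>f y. x i = gl_elem f y \<and> y \<in> {-1, 1}" using invertible_gl_elem[OF x] by metis
      then obtain f y where fy: "\<And>i. x i = gl_elem (f i) (y i)" "\<And>i. y i \<in> {-1, 1}" by metis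
      define G where "G s = (case s of Some (Var i) \<Rightarrow> f i | _ \<Rightarrow> t)" for s
      have "\<forall>s. \<exists>u v. G s = u + v \<and> u \<in> {-1, 1} \<and> v \<in> {-1, 1}" using sum_of_signs by blast
      then obtain u v where uv: "\<And>s. G s = u s + v s" "\<And>s. u s \<in> {-1, 1}" "\<And>s. v s \<in> {-1, 1}" by metis
      \<comment> \<open>Column 0 carries the sign of the matrix, columns 1 and 2 the two summands of
        its exponent, which is \<open>t\<close> for the terminator. The default 1 only has to be a
        sign.\<close>
      define F where "F s c = (if c = 0 then (case s of Some (Var i) \<Rightarrow> y i | _ \<Rightarrow> 1)
          else if c = 1 then u s else if c = 2 then v s else 1)" for s and c :: nat
      define a where "a = concat (map (\<lambda>r. map (\<lambda>c. if ?T ! r \<in> set (take r ?T) then 1 else F (?T ! r) c) [0..<4]) [0..<length ?T])"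
      have F: "F s c \<in> {-1, 1}" for s c
        using uv(2)[of s] uv(3)[of s] fy(2) by (auto simp: F_def split: option.splits letter.splits)
      have a: "length a = 4 * length ?T" "set a \<subseteq> {-1, 1}"
        using F by (auto simp: a_def length_concat o_def sum_list_triv)
      have merged: "merged ?T a c s = F s c" if "s \<in> set ?T" "c < 4" for s c
        unfolding a_def by (rule merged_prescribed[OF that])
      have "None \<in> set ?T" using False by (cases p) (auto simp: tokens_def)
      then have "tau ?T a None = t" using uv(1)[of None] by (simp add: merged F_def G_def)
      moreover have "x i = gl_elem (tau ?T a (Some (Var i))) (sigma ?T a (Some (Var i)))"
        if "Some (Var i) \<in> set ?T" for i
        using fy(1)[of i] that uv(1)[of "Some (Var i)"] by (simp add: merged F_def G_def)
      ultimately show "twist t (expr_value x p) = 0"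
        using exp_sum_eq_twist[OF p a, of x] B[OF a] by simp
    qed
  qed
  ultimately show ?thesis
    unfolding restricted_equivalence_problem_def exp_sum_problem_def reduction_def by auto
qed

end

section \<open>The reduction runs in polynomial time\<close>

lemma encode_reduction:
  "encode (exp_sum_problem \<alpha>) (reduction p) =
     replicate (4 * length (tokens p)) 6 @ output_from (tokens p) 0 (\<lambda>_. 0) True (tokens p)"
  by (simp add: exp_sum_problem_def reduction_def output_from_tokens)

lemma reduction_polytime:
  "polytime_computable restricted_exprs encode_expr (encode (exp_sum_problem \<alpha>)) reduction"
proof -
  obtain M where M: "wf_tm M" "symbols M = 7"
    "\<And>w n i v B k Y D t. reach (tape_content w) n (Copy, 0, [], \<lambda>_. 0, 0, \<lambda>_. 0, \<lambda>_. 0) (Halt, i, v, B, k, Y, D)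
       \<Longrightarrow> 5 * n \<le> t \<Longrightarrow> tm_computes_within M t w v"
    using machine_tm by blast
  \<comment> \<open>The factor is 250 = 5 * 50: the cubic bound counts macro steps, each of which
    takes at most five machine steps.\<close>
  define b :: "nat poly" where "b = [:250:] * [:1, 1:] ^ 3"
  have b: "poly b n = 5 * (50 * (n + 1) ^ 3)" for n by (simp add: b_def poly_power)
  have "set (encode_expr p) \<subseteq> {0<..<symbols M} \<and>
      tm_computes_within M (poly b (length (encode_expr p))) (encode_expr p) (encode (exp_sum_problem \<alpha>) (reduction p))" for p
  proof
    have "set (encode_token t) \<subseteq> {0<..<7}" for t
      using set_tail_symbols[of t] head_symbol_range[of t] by (auto simp: encode_token_def)
    then show "set (encode_expr p) \<subseteq> {0<..<symbols M}"
      unfolding encode_expr_tokens M(2) by fastforce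
    have len: "length (encode_expr p) = input_length (tokens p)"
      by (simp add: encode_expr_tokens input_length_def)
    obtain i k Y D where "reach (tape_content (encode_expr p)) (50 * (length (encode_expr p) + 1) ^ 3)
        (Copy, 0, [], \<lambda>_. 0, 0, \<lambda>_. 0, \<lambda>_. 0)
        (Halt, i, encode (exp_sum_problem \<alpha>) (reduction p), content (tokens p), k, Y, D)"
      using machine_run[of "tokens p"] unfolding len encode_reduction by (auto simp: content_def encode_expr_tokens)
    then show "tm_computes_within M (poly b (length (encode_expr p))) (encode_expr p) (encode (exp_sum_problem \<alpha>) (reduction p))"
      by (rule M(3)) (simp only: b order_refl)
  qed
  then show ?thesis unfolding polytime_computable_def using M(1) by blast
qed

theorem theorem6p5:
  fixes \<alpha> :: "'f::field"
  assumes "CARD('f) = 4"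
    and "primitive_element \<alpha>"
  shows "polytime_reducible restricted_equivalence_problem (exp_sum_problem \<alpha>)"
proof -
  interpret four_element_field \<alpha> using assms by unfold_locales
  have "instances restricted_equivalence_problem = restricted_exprs" "encode restricted_equivalence_problem = encode_expr"
    by (simp_all add: restricted_equivalence_problem_def)
  then show ?thesis
    unfolding polytime_reducible_def
    using reduction_polytime[of \<alpha>] reduction_correct reduction_instance[of _ \<alpha>] by auto
qed

end
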